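(* For every prime power $q$, there exists an $(r \times c, v)$-unordered triple array with $r = \frac{q^3 - 1}{q - 1}$, $c = \frac{q^4 - 1}{q - 1}$ and $v = \frac{(q^4 - 1)(q^3 - 1)}{(q^2 - 1)(q - 1)}$.
   Context: An $(r \times c, v)$-unordered triple array on a set $V$ of $v$ symbols is a collection of $c$-subsets $R_1, \dots, R_r \subseteq V$ (row-sets) and $r$-subsets $C_1, \dots, C_c \subseteq V$ (column-sets) such that, for some integers $e, \lambda_{rc}, \lambda_{rr}, \lambda_{cc}$, each symbol lies in exactly $e$ row-sets and exactly $e$ column-sets, $|R_i \cap C_j| = \lambda_{rc}$ for all $i,j$, $|R_i \cap R_s| = \lambda_{rr}$ for all $i \neq s$, and $|C_j \cap C_t| = \lambda_{cc}$ for all $j \neq t$. *)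

theory Defs
  imports "HOL-Number_Theory.Prime_Powers"
begin

text \<open>
  The row-sets and column-sets are indexed families \<open>R 1, \<dots>, R r\<close> and \<open>C 1, \<dots>, C c\<close>;
  values outside these index ranges are irrelevant. Since \<open>card\<close> of an infinite set is 0,
  finiteness of \<open>V\<close> is demanded explicitly. The parameters are natural numbers, as they
  are cardinalities.
\<close>

definition unordered_triple_array ::
  "nat \<Rightarrow> nat \<Rightarrow> nat \<Rightarrow> 'a set \<Rightarrow> (nat \<Rightarrow> 'a set) \<Rightarrow> (nat \<Rightarrow> 'a set) \<Rightarrow> bool" where
  "unordered_triple_array r c v V R C \<longleftrightarrow>
     finite V \<and> card V = v \<and>
     (\<forall>i\<in>{1..r}. R i \<subseteq> V \<and> card (R i) = c) \<and>
     (\<forall>j\<in>{1..c}. C j \<subseteq> V \<and> card (C j) = r) \<and>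
     (\<exists>e l_rc l_rr l_cc :: nat.
        (\<forall>x\<in>V. card {i\<in>{1..r}. x \<in> R i} = e \<and> card {j\<in>{1..c}. x \<in> C j} = e) \<and>
        (\<forall>i\<in>{1..r}. \<forall>j\<in>{1..c}. card (R i \<inter> C j) = l_rc) \<and>
        (\<forall>i\<in>{1..r}. \<forall>s\<in>{1..r}. i \<noteq> s \<longrightarrow> card (R i \<inter> R s) = l_rr) \<and>
        (\<forall>j\<in>{1..c}. \<forall>t\<in>{1..c}. j \<noteq> t \<longrightarrow> card (C j \<inter> C t) = l_cc))"

end

theory Submission
  imports Defs "HOL-Number_Theory.Residues" "HOL-Algebra.Algebraic_Closure"
begin

text \<open>
  The symbols are the lines of \<open>PG(3,q)\<close> and the column-sets are the pencils of lines through a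
  point. The lines are partitioned into \<open>q^2 + q + 1\<close> spreads, which are matched with the lines of a
  projective plane of order \<open>q\<close>; the row-set of a point of this plane is the union of the \<open>q + 1\<close>
  spreads matched with the plane lines through it. A row-set and a pencil then share one line for
  each of these \<open>q + 1\<close> spreads, and two row-sets share exactly one spread.

  For \<open>q > 2\<close> the spreads come from a regular spread and the \<open>q^2 + q\<close> images of a derived regular
  spread under a group fixing one line pointwise. Let \<open>K\<close> be the field with \<open>q^2\<close> elements,
  \<open>U\<close> its group of elements of norm 1 (\<open>unitary\<close>), and \<open>F_w = {t. t^q = w t}\<close> for \<open>w \<in> U\<close>
  (\<open>eigenspace w\<close>). Writing a point \<open>(x, y)\<close> of \<open>K^2\<close> with \<open>x \<noteq> 0\<close> as \<open>(u, z) = (x^q / x, y / x)\<close>, and a point \<open>(0, y)\<close> as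
  \<open>y^q / y\<close>, the points of \<open>PG(3,q)\<close> become \<open>U + U \<times> K\<close>. The derived spreads are indexed by the
  cosets \<open>B\<close> of the \<open>F_w\<close>, that is, by the lines of the affine plane \<open>K\<close>; the spread of \<open>(w, B)\<close>
  has the lines \<open>{u w} \<union> {u} \<times> B\<close> and \<open>{(u, s + f (a + b u w)). u \<in> U}\<close> with \<open>0 \<noteq> f \<in> F_w\<close>,
  \<open>s \<in> B\<close>. This works once \<open>a + b u\<close> never lies in the field \<open>F_1\<close> with \<open>q\<close> elements, that is, once
  no element of \<open>a + F_1\<close> has the norm of \<open>b\<close>; for \<open>q > 2\<close> some coset of \<open>F_1\<close> misses a nonzero
  value of the norm. For \<open>q = 2\<close> a cyclic Kirkman system on 15 points is used.

  Throughout it suffices to show that two points lie on at most one line: the parameters make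
  the corresponding counts tight.
\<close>

section \<open>Balanced families of sets\<close>

text \<open>The incidence dual of a 2-design: the members \<open>F i\<close> play the role of the points.\<close>

definition balanced_family :: "'s set \<Rightarrow> 'i set \<Rightarrow> ('i \<Rightarrow> 's set) \<Rightarrow> nat \<Rightarrow> nat \<Rightarrow> nat \<Rightarrow> bool" where
  "balanced_family V I F k e l \<longleftrightarrow>
     (\<forall>i\<in>I. F i \<subseteq> V \<and> card (F i) = k) \<and>
     (\<forall>x\<in>V. card {i \<in> I. x \<in> F i} = e) \<and>
     (\<forall>i\<in>I. \<forall>j\<in>I. i \<noteq> j \<longrightarrow> card (F i \<inter> F j) = l)"

lemma balanced_familyI [intro?]:
  assumes "\<And>i. i \<in> I \<Longrightarrow> F i \<subseteq> V" "\<And>i. i \<in> I \<Longrightarrow> card (F i) = k"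
    and "\<And>x. x \<in> V \<Longrightarrow> card {i \<in> I. x \<in> F i} = e"
    and "\<And>i j. \<lbrakk>i \<in> I; j \<in> I; i \<noteq> j\<rbrakk> \<Longrightarrow> card (F i \<inter> F j) = l"
  shows "balanced_family V I F k e l"
  using assms by (simp add: balanced_family_def)

lemma balanced_familyD:
  assumes "balanced_family V I F k e l"
  shows "i \<in> I \<Longrightarrow> F i \<subseteq> V" "i \<in> I \<Longrightarrow> card (F i) = k"
    and "x \<in> V \<Longrightarrow> card {i \<in> I. x \<in> F i} = e"
    and "\<lbrakk>i \<in> I; j \<in> I; i \<noteq> j\<rbrakk> \<Longrightarrow> card (F i \<inter> F j) = l"
  using assms by (auto simp: balanced_family_def)

lemma balanced_family_reindex:
  assumes f: "bij_betw f I' I" and F: "balanced_family V I F k e l"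
  shows "balanced_family V I' (F \<circ> f) k e l"
proof
  fix x assume "x \<in> V"
  have "f ` {i \<in> I'. x \<in> F (f i)} = {i \<in> I. x \<in> F i}"
    using bij_betw_imp_surj_on[OF f] by blast
  moreover have "inj_on f {i \<in> I'. x \<in> F (f i)}"
    using bij_betw_imp_inj_on[OF f] by (rule inj_on_subset) blast
  ultimately show "card {i \<in> I'. x \<in> (F \<circ> f) i} = e"
    using balanced_familyD(3)[OF F \<open>x \<in> V\<close>] card_image by fastforce
next
  fix i j assume "i \<in> I'" "j \<in> I'" "i \<noteq> j"
  then show "card ((F \<circ> f) i \<inter> (F \<circ> f) j) = l"
    using balanced_familyD(4)[OF F] bij_betw_apply[OF f] bij_betw_imp_inj_on[OF f]
    by (simp add: inj_on_eq_iff)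
qed (use balanced_familyD(1,2)[OF F] bij_betw_apply[OF f] in simp_all)

lemma balanced_family_image:
  assumes g: "inj_on g V" and F: "balanced_family V I F k e l"
  shows "balanced_family (g ` V) I (\<lambda>i. g ` F i) k e l"
proof
  have card_image_g: "card (g ` A) = card A" if "A \<subseteq> V" for A
    using g that by (meson card_image inj_on_subset)
  note subset = balanced_familyD(1)[OF F]
  fix i assume i: "i \<in> I"
  show "g ` F i \<subseteq> g ` V" using subset[OF i] by blast
  show "card (g ` F i) = k" using card_image_g[OF subset[OF i]] balanced_familyD(2)[OF F i] by simp
  fix j assume j: "j \<in> I" "i \<noteq> j"
  have "g ` F i \<inter> g ` F j = g ` (F i \<inter> F j)"
    using inj_on_image_Int[OF g subset[OF i] subset[OF j(1)]] by simp
  then show "card (g ` F i \<inter> g ` F j) = l"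
    using card_image_g[of "F i \<inter> F j"] subset[OF i] balanced_familyD(4)[OF F i j] by auto
next
  fix y assume "y \<in> g ` V"
  then obtain x where "x \<in> V" "y = g x" by blast
  then have "{i \<in> I. y \<in> g ` F i} = {i \<in> I. x \<in> F i}"
    using inj_on_image_mem_iff[OF g \<open>x \<in> V\<close> balanced_familyD(1)[OF F]] by auto
  then show "card {i \<in> I. y \<in> g ` F i} = e"
    using balanced_familyD(3)[OF F \<open>x \<in> V\<close>] by simp
qed

lemma card_Sigma_const:
  assumes "finite A" "\<And>x. x \<in> A \<Longrightarrow> finite (B x)" "\<And>x. x \<in> A \<Longrightarrow> card (B x) = m"
  shows "card (Sigma A B) = card A * m"
  using assms by (simp add: card_SigmaI)

lemma balanced_family_Sigma:
  assumes "finite V" and B: "\<And>x. x \<in> V \<Longrightarrow> finite (B x)" "\<And>x. x \<in> V \<Longrightarrow> card (B x) = m"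
    and F: "balanced_family V I F k e l"
  shows "balanced_family (Sigma V B) I (\<lambda>i. Sigma (F i) B) (k * m) e (l * m)"
proof
  have card_Sigma_B: "card (Sigma A B) = card A * m" if "A \<subseteq> V" for A
    using that assms by (intro card_Sigma_const) (auto intro: finite_subset)
  note subset = balanced_familyD(1)[OF F]
  fix i assume i: "i \<in> I"
  show "Sigma (F i) B \<subseteq> Sigma V B" using subset[OF i] by blast
  show "card (Sigma (F i) B) = k * m"
    using card_Sigma_B[OF subset[OF i]] balanced_familyD(2)[OF F i] by simp
  fix j assume j: "j \<in> I" "i \<noteq> j"
  have "card (Sigma (F i \<inter> F j) B) = l * m"
    using card_Sigma_B[of "F i \<inter> F j"] subset[OF i] balanced_familyD(4)[OF F i j] by auto
  then show "card (Sigma (F i) B \<inter> Sigma (F j) B) = l * m"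
    by (simp only: Sigma_Int_distrib1)
next
  fix z assume "z \<in> Sigma V B"
  then obtain x y where z: "z = (x, y)" "x \<in> V" "y \<in> B x" by blast
  then have "{i \<in> I. z \<in> Sigma (F i) B} = {i \<in> I. x \<in> F i}" by blast
  then show "card {i \<in> I. z \<in> Sigma (F i) B} = e" using balanced_familyD(3)[OF F z(2)] by simp
qed

lemma unordered_triple_arrayI:
  assumes "finite V" "balanced_family V {1..r} R c e l_rr" "balanced_family V {1..c} C r e l_cc"
    and "\<And>i j. \<lbrakk>i \<in> {1..r}; j \<in> {1..c}\<rbrakk> \<Longrightarrow> card (R i \<inter> C j) = l_rc"
  shows "unordered_triple_array r c (card V) V R C"
  unfolding unordered_triple_array_def
proof (intro conjI, goal_cases)
  case 5
  show ?case
    by (rule exI[of _ e], rule exI[of _ l_rc], rule exI[of _ l_rr], rule exI[of _ l_cc])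
      (use assms in \<open>simp add: balanced_family_def\<close>)
qed (use assms in \<open>simp_all add: balanced_family_def\<close>)

lemma exists_unordered_triple_array_on_nat:
  assumes "finite V" "finite I" "finite J"
    and R: "balanced_family V I R (card J) e l_rr" and C: "balanced_family V J C (card I) e l_cc"
    and cross: "\<And>i j. \<lbrakk>i \<in> I; j \<in> J\<rbrakk> \<Longrightarrow> card (R i \<inter> C j) = l_rc"
  shows "\<exists>(V' :: nat set) R' C'. unordered_triple_array (card I) (card J) (card V) V' R' C'"
proof -
  obtain f where f: "bij_betw f {1..card I} I"
    using ex_bij_betw_nat_finite_1[OF \<open>finite I\<close>] by blast
  obtain h where h: "bij_betw h {1..card J} J"
    using ex_bij_betw_nat_finite_1[OF \<open>finite J\<close>] by blast
  obtain g :: "_ \<Rightarrow> nat" where g: "inj_on g V"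
    using finite_imp_inj_to_nat_seg[OF \<open>finite V\<close>] by blast
  let ?R = "\<lambda>i. g ` (R \<circ> f) i" and ?C = "\<lambda>j. g ` (C \<circ> h) j"
  have "unordered_triple_array (card I) (card J) (card (g ` V)) (g ` V) ?R ?C"
  proof (rule unordered_triple_arrayI)
    show "balanced_family (g ` V) {1..card I} ?R (card J) e l_rr"
      using balanced_family_image[OF g balanced_family_reindex[OF f R]] .
    show "balanced_family (g ` V) {1..card J} ?C (card I) e l_cc"
      using balanced_family_image[OF g balanced_family_reindex[OF h C]] .
  next
    fix i j assume "i \<in> {1..card I}" "j \<in> {1..card J}"
    then have ij: "f i \<in> I" "h j \<in> J" using bij_betw_apply[OF f] bij_betw_apply[OF h] by simp_all
    note subset = balanced_familyD(1)[OF R ij(1)] balanced_familyD(1)[OF C ij(2)]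
    have "?R i \<inter> ?C j = g ` (R (f i) \<inter> C (h j))"
      using inj_on_image_Int[OF g subset] by simp
    moreover have "inj_on g (R (f i) \<inter> C (h j))"
      using g by (rule inj_on_subset) (use subset in blast)
    ultimately show "card (?R i \<inter> ?C j) = l_rc" using cross[OF ij] card_image by metis
  qed (use \<open>finite V\<close> in simp)
  then show ?thesis using card_image[OF g] by auto
qed

section \<open>Linear spaces and parallelisms\<close>

lemma card_off_diagonal:
  assumes "finite A"
  shows "card {(x, y). x \<in> A \<and> y \<in> A \<and> x \<noteq> y} = card A * (card A - 1)"
proof -
  have "{(x, y). x \<in> A \<and> y \<in> A \<and> x \<noteq> y} = Sigma A (\<lambda>x. A - {x})" by auto
  then show ?thesis using assms by (simp add: card_Sigma_const)
qed

locale full_linear_space =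
  fixes S :: "'a set" and J :: "'i set" and line :: "'i \<Rightarrow> 'a set" and m :: nat
  assumes finite_points: "finite S" and finite_index: "finite J"
    and line_subset: "j \<in> J \<Longrightarrow> line j \<subseteq> S"
    and card_line: "j \<in> J \<Longrightarrow> card (line j) = m"
    and at_most_one: "\<lbrakk>j \<in> J; j' \<in> J; x \<noteq> y; x \<in> line j; y \<in> line j; x \<in> line j'; y \<in> line j'\<rbrakk> \<Longrightarrow> j = j'"
    and full: "card J * (m * (m - 1)) = card S * (card S - 1)"
begin

definition star :: "'a \<Rightarrow> 'i set" where
  "star x = {j \<in> J. x \<in> line j}"

lemma finite_line: "j \<in> J \<Longrightarrow> finite (line j)"
  using line_subset finite_points finite_subset by blast

text \<open>By \<open>full\<close>, the lines together have as many ordered pairs of distinct points as \<open>S\<close>.\<close>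

lemma line_through:
  assumes "x \<in> S" "y \<in> S" "x \<noteq> y"
  obtains j where "j \<in> J" "x \<in> line j" "y \<in> line j"
proof -
  let ?pairs = "\<lambda>A. {(x, y). x \<in> A \<and> y \<in> A \<and> x \<noteq> y}"
  let ?flags = "Sigma J (\<lambda>j. ?pairs (line j))"
  have finite_pairs: "finite (?pairs A)" if "finite A" for A :: "'a set"
    by (rule finite_subset[of _ "A \<times> A"]) (use that in auto)
  have "card ?flags = card J * (m * (m - 1))"
    using finite_index finite_line finite_pairs card_off_diagonal card_line
    by (intro card_Sigma_const) auto
  then have "card ?flags = card (?pairs S)"
    using full card_off_diagonal[OF finite_points] by simp
  moreover have "inj_on snd ?flags"
    using at_most_one by (auto simp: inj_on_def)
  ultimately have "card (snd ` ?flags) = card (?pairs S)"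
    by (simp add: card_image)
  moreover have "snd ` ?flags \<subseteq> ?pairs S" using line_subset by force
  ultimately have "snd ` ?flags = ?pairs S"
    using finite_pairs[OF finite_points] card_subset_eq by blast
  then have "(x, y) \<in> snd ` ?flags" using assms by auto
  then show ?thesis using that by auto
qed

lemma card_star_Int:
  assumes "x \<in> S" "y \<in> S" "x \<noteq> y"
  shows "card (star x \<inter> star y) = 1"
proof -
  obtain j where "j \<in> J" "x \<in> line j" "y \<in> line j" using line_through[OF assms] .
  then have "star x \<inter> star y = {j}" using at_most_one assms(3) by (auto simp: star_def)
  then show ?thesis by simp
qed

lemma card_star:
  assumes "x \<in> S"
  shows "card (star x) * (m - 1) = card S - 1"
proof -
  have star: "j \<in> J" "x \<in> line j" if "j \<in> star x" for j
    using that by (auto simp: star_def)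
  have "S - {x} = (\<Union>j\<in>star x. line j - {x})"
  proof (intro equalityI subsetI)
    fix y assume y: "y \<in> S - {x}"
    then obtain j where "j \<in> J" "x \<in> line j" "y \<in> line j"
      using line_through[of x y] assms by blast
    then show "y \<in> (\<Union>j\<in>star x. line j - {x})" using y by (auto simp: star_def)
  qed (use line_subset star in blast)
  also have "card \<dots> = (\<Sum>j\<in>star x. card (line j - {x}))"
  proof (rule card_UN_disjoint)
    show "finite (star x)" using finite_index by (simp add: star_def)
    show "\<forall>j\<in>star x. \<forall>j'\<in>star x. j \<noteq> j' \<longrightarrow> (line j - {x}) \<inter> (line j' - {x}) = {}"
      using at_most_one star by blast
  qed (use finite_line star in auto)
  also have "\<dots> = (\<Sum>j\<in>star x. m - 1)"
    using card_line finite_line star by (intro sum.cong) (auto simp: card_Diff_singleton)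
  finally show ?thesis using assms finite_points by simp
qed

lemma balanced_family_star:
  assumes "1 < m" "card S - 1 = k * (m - 1)"
  shows "balanced_family J S star k m 1"
proof
  show "card (star x) = k" if "x \<in> S" for x
    using card_star[OF that] assms by simp
next
  fix j assume "j \<in> J"
  then have "{x \<in> S. j \<in> star x} = line j" using line_subset by (auto simp: star_def)
  then show "card {x \<in> S. j \<in> star x} = m" using card_line[OF \<open>j \<in> J\<close>] by simp
qed (auto simp: star_def card_star_Int[unfolded star_def])

end

locale plane_indexed_parallelism =
  fixes q :: nat and P :: "'p set" and N :: "'k set" and spread :: "'k \<Rightarrow> 'p set set"
    and I :: "'i set" and plane_line :: "'k \<Rightarrow> 'i set"
  assumes q_pos: "0 < q"
    and finite_P: "finite P" and card_P: "card P = (q + 1) * (q\<^sup>2 + 1)"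
    and finite_N: "finite N" and card_N: "card N = q\<^sup>2 + q + 1"
    and finite_I: "finite I" and card_I: "card I = q\<^sup>2 + q + 1"
    and card_spread: "k \<in> N \<Longrightarrow> card (spread k) = q\<^sup>2 + 1"
    and spread_subset: "\<lbrakk>k \<in> N; L \<in> spread k\<rbrakk> \<Longrightarrow> L \<subseteq> P"
    and card_in_spread: "\<lbrakk>k \<in> N; L \<in> spread k\<rbrakk> \<Longrightarrow> card L = q + 1"
    and spread_disjoint: "\<lbrakk>k \<in> N; L \<in> spread k; L' \<in> spread k; x \<in> L; x \<in> L'\<rbrakk> \<Longrightarrow> L = L'"
    and spread_unique: "\<lbrakk>k \<in> N; k' \<in> N; L \<in> spread k; L' \<in> spread k'; x \<noteq> y;
      x \<in> L; y \<in> L; x \<in> L'; y \<in> L'\<rbrakk> \<Longrightarrow> k = k'"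
    and plane_line_subset: "k \<in> N \<Longrightarrow> plane_line k \<subseteq> I"
    and card_plane_line: "k \<in> N \<Longrightarrow> card (plane_line k) = q + 1"
    and plane_line_unique: "\<lbrakk>k \<in> N; k' \<in> N; i \<noteq> s; i \<in> plane_line k; s \<in> plane_line k;
      i \<in> plane_line k'; s \<in> plane_line k'\<rbrakk> \<Longrightarrow> k = k'"
begin

lemma finite_spread: "k \<in> N \<Longrightarrow> finite (spread k)"
  using card_spread by (metis add_is_0 card.infinite zero_neq_one)

lemma card_lines: "card (Sigma N spread) = (q\<^sup>2 + q + 1) * (q\<^sup>2 + 1)"
  using card_Sigma_const[OF finite_N finite_spread card_spread] card_N by simp

lemma inj_on_fst_lines_through: "inj_on fst {j \<in> Sigma N spread. x \<in> snd j}"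
proof (rule inj_onI, clarsimp)
  fix k L L' assume "k \<in> N" "L \<in> spread k" "L' \<in> spread k" "x \<in> L" "x \<in> L'"
  then show "L = L'" by (rule spread_disjoint)
qed

lemma card_P_minus_1: "card P - 1 = (q\<^sup>2 + q + 1) * q"
  by (simp add: card_P algebra_simps power2_eq_square)

sublocale plane: full_linear_space I N plane_line "q + 1"
  using finite_I finite_N plane_line_subset card_plane_line plane_line_unique card_N card_I
  by unfold_locales (auto simp: algebra_simps power2_eq_square)

sublocale space: full_linear_space P "Sigma N spread" snd "q + 1"
proof
  show "finite (Sigma N spread)" using finite_N finite_spread by blast
  show "card (Sigma N spread) * ((q + 1) * (q + 1 - 1)) = card P * (card P - 1)"
    unfolding card_lines card_P_minus_1 by (simp add: card_P algebra_simps)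
  fix j j' x y
  assume pair: "j \<in> Sigma N spread" "j' \<in> Sigma N spread" "x \<noteq> y"
    "x \<in> snd j" "y \<in> snd j" "x \<in> snd j'" "y \<in> snd j'"
  then have "fst j = fst j'" using spread_unique[of "fst j" "fst j'"] by force
  then show "j = j'" using inj_onD[OF inj_on_fst_lines_through[of x]] pair by blast
qed (use finite_P spread_subset card_in_spread in force)+

lemma balanced_family_plane_star: "balanced_family N I plane.star (q + 1) (q + 1) 1"
  using q_pos by (intro plane.balanced_family_star) (simp_all add: card_I power2_eq_square)

lemma balanced_family_space_star:
  "balanced_family (Sigma N spread) P space.star (q\<^sup>2 + q + 1) (q + 1) 1"
  using q_pos by (intro space.balanced_family_star) (simp_all only: card_P_minus_1, simp_all)

lemma fst_space_star:
  assumes "x \<in> P"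
  shows "fst ` space.star x = N"
proof (rule card_subset_eq[OF finite_N])
  show "fst ` space.star x \<subseteq> N" by (auto simp: space.star_def)
  have "inj_on fst (space.star x)"
    using inj_on_fst_lines_through by (simp add: space.star_def)
  then have "card (fst ` space.star x) = card (space.star x)" by (rule card_image)
  also have "\<dots> = card N"
    using balanced_familyD(2)[OF balanced_family_space_star assms] card_N by simp
  finally show "card (fst ` space.star x) = card N" .
qed

lemma card_union_of_spreads_Int_star:
  assumes "A \<subseteq> N" "x \<in> P"
  shows "card (Sigma A spread \<inter> space.star x) = card A"
proof (rule bij_betw_same_card[of fst], rule bij_betw_imageI)
  show "inj_on fst (Sigma A spread \<inter> space.star x)"
    using inj_on_fst_lines_through by (rule inj_on_subset) (auto simp: space.star_def)
  show "fst ` (Sigma A spread \<inter> space.star x) = A"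
  proof (intro equalityI subsetI)
    fix k assume "k \<in> A"
    then obtain L where "(k, L) \<in> space.star x"
      using fst_space_star[OF assms(2)] assms(1) by force
    then show "k \<in> fst ` (Sigma A spread \<inter> space.star x)"
      using \<open>k \<in> A\<close> by (force simp: space.star_def)
  qed auto
qed

theorem exists_unordered_triple_array:
  "\<exists>(V :: nat set) R C. unordered_triple_array (q\<^sup>2 + q + 1) ((q + 1) * (q\<^sup>2 + 1))
     ((q\<^sup>2 + q + 1) * (q\<^sup>2 + 1)) V R C"
proof -
  let ?R = "\<lambda>i. Sigma (plane.star i) spread"
  have "balanced_family (Sigma N spread) I ?R ((q + 1) * (q\<^sup>2 + 1)) (q + 1) (1 * (q\<^sup>2 + 1))"
    by (intro balanced_family_Sigma balanced_family_plane_star finite_N finite_spread card_spread)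
  moreover have "card (?R i \<inter> space.star x) = q + 1" if "i \<in> I" "x \<in> P" for i x
    using card_union_of_spreads_Int_star[of "plane.star i" x] that
      balanced_familyD(1,2)[OF balanced_family_plane_star] by simp
  ultimately have "\<exists>(V :: nat set) R C.
      unordered_triple_array (card I) (card P) (card (Sigma N spread)) V R C"
    using balanced_family_space_star space.finite_index finite_I finite_P
    by (intro exists_unordered_triple_array_on_nat[where R = ?R and C = space.star])
      (simp_all only: card_I card_P)
  then show ?thesis by (simp only: card_I card_P card_lines)
qed

end

section \<open>Finite fields\<close>

lemma (in cring) binomial_expansion:
  assumes [simp]: "x \<in> carrier R" "y \<in> carrier R"
  shows "(x \<oplus> y) [^] n = (\<Oplus>k\<in>{..n}. [(n choose k)] \<cdot> (x [^] k \<otimes> y [^] (n - k)))"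
proof (induction n)
  case 0
  show ?case by simp
next
  case (Suc n)
  let ?t = "\<lambda>k. x [^] k \<otimes> y [^] (n - k)"
  let ?u = "\<lambda>k. x [^] Suc k \<otimes> y [^] (n - k)"
  let ?v = "\<lambda>k. x [^] k \<otimes> y [^] (Suc n - k)"
  have mult_x: "(\<Oplus>k\<in>{..n}. [(n choose k)] \<cdot> ?t k) \<otimes> x = (\<Oplus>k\<in>{..n}. [(n choose k)] \<cdot> ?u k)"
    by (subst finsum_ldistr) (auto intro!: finsum_cong' simp: add_pow_ldistr add_pow_rdistr m_ac)
  have mult_y: "(\<Oplus>k\<in>{..n}. [(n choose k)] \<cdot> ?t k) \<otimes> y = (\<Oplus>k\<in>{..n}. [(n choose k)] \<cdot> ?v k)"
    by (subst finsum_ldistr) (auto intro!: finsum_cong' simp: add_pow_ldistr add_pow_rdistr m_ac Suc_diff_le)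
  have "(\<Oplus>k\<in>{..Suc n}. [(Suc n choose k)] \<cdot> ?v k)
      = (\<Oplus>k\<in>{..n}. [(n choose k)] \<cdot> ?u k \<oplus> [(n choose Suc k)] \<cdot> ?u k) \<oplus> y [^] Suc n"
    by (subst finsum_Suc2) (auto intro!: arg_cong2[where f = "(\<oplus>)"] finsum_cong' simp: add.nat_pow_mult)
  also have "\<dots> = (\<Oplus>k\<in>{..n}. [(n choose k)] \<cdot> ?u k) \<oplus>
      ((\<Oplus>k\<in>{..n}. [(n choose Suc k)] \<cdot> ?u k) \<oplus> y [^] Suc n)"
    by (subst finsum_addf) (auto simp: a_assoc)
  also have "(\<Oplus>k\<in>{..n}. [(n choose Suc k)] \<cdot> ?u k) \<oplus> y [^] Suc n
      = (\<Oplus>k\<in>{..Suc n}. [(n choose k)] \<cdot> ?v k)"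
    by (subst finsum_Suc2) auto
  also have "\<dots> = (\<Oplus>k\<in>{..n}. [(n choose k)] \<cdot> ?v k)"
    by (subst finsum_Suc) (auto simp: binomial_eq_0)
  finally show ?case
    using Suc.IH mult_x mult_y by (simp add: r_distr)
qed

lemma (in cring) mult_pow_minus_one:
  assumes "x \<in> carrier R" "0 < n"
  shows "x \<otimes> (x [^] (n - 1) \<ominus> \<one>) = x [^] (n::nat) \<ominus> x"
  using assms nat_pow_Suc2[OF assms(1), of "n - 1"]
  by (simp add: a_minus_def r_distr r_minus)

locale prime_char_ring = cring +
  fixes p :: nat
  assumes prime_p: "Factorial_Ring.prime p" and char_p: "[p] \<cdot> \<one> = \<zero>"
begin

lemma add_pow_eq_zero_if_dvd:
  assumes "p dvd n" "x \<in> carrier R"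
  shows "[n] \<cdot> x = \<zero>"
proof -
  obtain m where "n = p * m" using assms(1) by blast
  then have "[n] \<cdot> \<one> = \<zero>"
    using add.nat_pow_pow[of "\<one>" m p] char_p by simp
  then show ?thesis
    using add_pow_ldistr[of "\<one>" x n] assms(2) by simp
qed

lemma pow_prime_add:
  assumes [simp]: "x \<in> carrier R" "y \<in> carrier R"
  shows "(x \<oplus> y) [^] p = x [^] p \<oplus> y [^] p"
proof -
  let ?f = "\<lambda>k. [(p choose k)] \<cdot> (x [^] k \<otimes> y [^] (p - k))"
  have "p > 0" using prime_p prime_gt_0_nat by blast
  have "{..p} = insert 0 (insert p {1..<p})" by auto
  then have "(x \<oplus> y) [^] p = ?f 0 \<oplus> (?f p \<oplus> (\<Oplus>k\<in>{1..<p}. ?f k))"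
    using \<open>p > 0\<close> by (simp add: binomial_expansion)
  also have "(\<Oplus>k\<in>{1..<p}. ?f k) = (\<Oplus>k\<in>{1..<p}. \<zero>)"
  proof (rule finsum_cong')
    fix k assume "k \<in> {1..<p}"
    then have "p dvd (p choose k)"
      using prime_p by (intro dvd_choose_prime) auto
    then show "?f k = \<zero>" using add_pow_eq_zero_if_dvd by simp
  qed auto
  finally show ?thesis by (simp add: a_comm)
qed

lemma pow_prime_power_add:
  assumes [simp]: "x \<in> carrier R" "y \<in> carrier R"
  shows "(x \<oplus> y) [^] (p ^ m) = x [^] (p ^ m) \<oplus> y [^] (p ^ m)"
proof (induction m)
  case (Suc m)
  have "z [^] (p ^ Suc m) = (z [^] (p ^ m)) [^] p" if "z \<in> carrier R" for z
    using that by (simp add: nat_pow_pow mult.commute)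
  then show ?case using Suc pow_prime_add by simp
qed simp

lemma pow_prime_power_minus:
  assumes [simp]: "x \<in> carrier R"
  shows "(\<ominus> x) [^] (p ^ m) = \<ominus> (x [^] (p ^ m))"
proof -
  have "p ^ m > 0" using prime_p prime_gt_0_nat by simp
  then have "(\<ominus> x) [^] (p ^ m) \<oplus> x [^] (p ^ m) = \<zero>"
    using pow_prime_power_add[of "\<ominus> x" x m] by (simp add: l_neg nat_pow_zero)
  then show ?thesis by (simp add: minus_equality)
qed

lemma pow_prime_power_minus_self_add:
  assumes "x \<in> carrier R" "c \<in> carrier R" "c [^] (p ^ m) = c"
  shows "(x \<oplus> c) [^] (p ^ m) \<ominus> (x \<oplus> c) = x [^] (p ^ m) \<ominus> x"
proof -
  have "(y \<oplus> c) \<ominus> (x \<oplus> c) = y \<ominus> x" if "y \<in> carrier R" for y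
    using assms(1,2) that by algebra
  then show ?thesis using assms by (simp add: pow_prime_power_add)
qed

end

lemma (in ring_hom_ring) hom_add_pow:
  "x \<in> carrier R \<Longrightarrow> h ([(n::nat)] \<cdot>\<^bsub>R\<^esub> x) = [n] \<cdot>\<^bsub>S\<^esub> h x"
  by (induction n) simp_all

lemma (in ring_hom_ring) prime_char_ring_codomain:
  assumes "cring S" "prime_char_ring R p"
  shows "prime_char_ring S p"
proof (intro prime_char_ring.intro prime_char_ring_axioms.intro)
  show "Factorial_Ring.prime p" using assms(2) by (rule prime_char_ring.prime_p)
  show "[p] \<cdot>\<^bsub>S\<^esub> \<one>\<^bsub>S\<^esub> = \<zero>\<^bsub>S\<^esub>"
    using hom_add_pow[of "\<one>" p] prime_char_ring.char_p[OF assms(2)] by simp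
qed (rule assms(1))

definition (in ring) pow_minus_var :: "nat \<Rightarrow> 'a list" where
  "pow_minus_var n = X [^]\<^bsub>poly_ring R\<^esub> n \<ominus>\<^bsub>poly_ring R\<^esub> X"

definition (in ring) pow_fixed :: "nat \<Rightarrow> 'a set" where
  "pow_fixed n = {x \<in> carrier R. x [^] n = x}"

lemma (in domain) pow_minus_var_closed: "pow_minus_var n \<in> carrier (poly_ring R)"
proof -
  interpret UP: domain "poly_ring R"
    using univ_poly_is_domain[OF carrier_is_subring] .
  show ?thesis using var_closed(1)[OF carrier_is_subring] by (simp add: pow_minus_var_def)
qed

lemma (in domain) eval_pow_minus_var:
  assumes "x \<in> carrier R"
  shows "eval (pow_minus_var n) x = x [^] n \<ominus> x"
proof -
  interpret E: ring_hom_cring "poly_ring R" R "\<lambda>p. eval p x"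
    using eval_cring_hom[OF carrier_is_subring assms] .
  show ?thesis
    using var_closed(1)[OF carrier_is_subring] eval_var[OF assms]
    by (simp add: pow_minus_var_def a_minus_def)
qed

lemma (in field) degree_pow_minus_var:
  assumes "1 < n"
  shows "degree (pow_minus_var n) = n"
proof -
  interpret UP: domain "poly_ring R"
    using univ_poly_is_domain[OF carrier_is_subring] .
  have X: "X \<in> carrier (poly_ring R)" "degree X = 1"
    using var_closed(1)[OF carrier_is_subring] by (auto simp: var_def)
  have degree_minus_X: "degree (\<ominus>\<^bsub>poly_ring R\<^esub> X) = 1"
    using univ_poly_a_inv_degree[OF carrier_is_subring X(1)] X(2) by simp
  have degree_X_pow: "degree (X [^]\<^bsub>poly_ring R\<^esub> n) = n"
    using polynomial_pow_degree[OF X(1)] X(2) by simp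
  show ?thesis
    unfolding pow_minus_var_def a_minus_def univ_poly_add
    using poly_add_degree_eq[OF carrier_is_subring, of "X [^]\<^bsub>poly_ring R\<^esub> n" "\<ominus>\<^bsub>poly_ring R\<^esub> X"]
      degree_minus_X degree_X_pow assms X(1) by (simp add: univ_poly_carrier)
qed

text \<open>In characteristic \<open>p\<close>, one has \<open>X^n - X = (X - a)^n - (X - a)\<close> for every root \<open>a\<close>.\<close>

lemma (in field) pow_minus_var_factor:
  fixes p m :: nat
  defines "n \<equiv> p ^ m"
  assumes "prime_char_ring R p" and a: "a \<in> carrier R" "a [^] n = a"
  shows "pow_minus_var n = [\<one>, \<ominus> a] \<otimes>\<^bsub>poly_ring R\<^esub>
    ([\<one>, \<ominus> a] [^]\<^bsub>poly_ring R\<^esub> (n - 1) \<ominus>\<^bsub>poly_ring R\<^esub> \<one>\<^bsub>poly_ring R\<^esub>)"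
proof -
  interpret UP: domain "poly_ring R"
    using univ_poly_is_domain[OF carrier_is_subring] .
  interpret const: ring_hom_ring R "poly_ring R" poly_of_const
    using canonical_embedding_ring_hom[OF carrier_is_subring] by simp
  interpret R: prime_char_ring R p by fact
  interpret UP: prime_char_ring "poly_ring R" p
    using const.prime_char_ring_codomain UP.is_cring assms(2) by blast
  let ?c = "poly_of_const (\<ominus> a)"
  have X: "X \<in> carrier (poly_ring R)" using var_closed(1)[OF carrier_is_subring] .
  have c: "?c \<in> carrier (poly_ring R)" using a(1) by simp
  have linear: "[\<one>, \<ominus> a] = X \<oplus>\<^bsub>poly_ring R\<^esub> ?c"
    using a(1) by (auto simp: univ_poly_add var_def poly_of_const_def)
  have "(\<ominus> a) [^] n = \<ominus> a"
    using R.pow_prime_power_minus[OF a(1), of m] a(2) by (simp add: n_def)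
  then have "?c [^]\<^bsub>poly_ring R\<^esub> n = ?c"
    using const.hom_nat_pow[of "\<ominus> a" n] a(1) by simp
  then have "pow_minus_var n = [\<one>, \<ominus> a] [^]\<^bsub>poly_ring R\<^esub> n \<ominus>\<^bsub>poly_ring R\<^esub> [\<one>, \<ominus> a]"
    unfolding linear pow_minus_var_def n_def using UP.pow_prime_power_minus_self_add[OF X c] by simp
  moreover have "0 < n" using prime_gt_0_nat[OF R.prime_p] by (simp add: n_def)
  moreover have "[\<one>, \<ominus> a] \<in> carrier (poly_ring R)" unfolding linear using X c by simp
  ultimately show ?thesis using UP.mult_pow_minus_one by simp
qed

lemma (in field) count_roots_pow_minus_var:
  fixes p m :: nat
  defines "n \<equiv> p ^ m"
  assumes p: "prime_char_ring R p" and n: "1 < n" and a: "a \<in> pow_fixed n"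
  shows "count (roots (pow_minus_var n)) a = 1"
proof -
  interpret UP: domain "poly_ring R"
    using univ_poly_is_domain[OF carrier_is_subring] .
  have a: "a \<in> carrier R" "a [^] n = a" using a by (auto simp: pow_fixed_def)
  interpret E: ring_hom_cring "poly_ring R" R "\<lambda>p. eval p a"
    using eval_cring_hom[OF carrier_is_subring a(1)] .
  let ?D = "[\<one>, \<ominus> a]"
  let ?Q = "?D [^]\<^bsub>poly_ring R\<^esub> (n - 1) \<ominus>\<^bsub>poly_ring R\<^esub> \<one>\<^bsub>poly_ring R\<^esub>"
  have D: "?D \<in> carrier (poly_ring R)"
    using a(1) by (simp add: sym[OF univ_poly_carrier] polynomial_def)
  have Q: "?Q \<in> carrier (poly_ring R)" using D by simp
  have "eval ?D a = \<zero>" using a(1) by (simp add: r_neg)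
  then have "eval ?Q a = \<ominus> \<one>"
    using D n by (simp add: a_minus_def nat_pow_zero del: eval.simps)
  then have eval_Q: "eval ?Q a \<noteq> \<zero>"
    using one_not_zero by (metis add.inv_eq_1_iff one_closed)
  then have "?Q \<noteq> []" by auto
  then have "roots (pow_minus_var n) = add_mset a (roots ?Q)"
    using poly_mult_degree_one_monic_imp_same_roots[OF a(1) Q]
      pow_minus_var_factor[OF p a(1), of m] a(2) by (simp add: n_def)
  moreover have "a \<notin># roots ?Q"
    using eval_Q roots_mem_iff_is_root[OF Q] by (simp add: is_root_def)
  ultimately show ?thesis by (simp add: not_in_iff)
qed

lemma (in algebraically_closed) card_pow_fixed:
  fixes p m :: nat
  defines "n \<equiv> p ^ m"
  assumes p: "prime_char_ring L p" and n: "1 < n"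
  shows "finite (pow_fixed n)" and "card (pow_fixed n) = n"
proof -
  have "pow_minus_var n \<noteq> []" using degree_pow_minus_var[OF n] n by auto
  then have "is_root (pow_minus_var n) x \<longleftrightarrow> x \<in> pow_fixed n" for x
    unfolding is_root_def pow_fixed_def by (auto simp: eval_pow_minus_var)
  then have set_roots: "set_mset (roots (pow_minus_var n)) = pow_fixed n"
    using roots_mem_iff_is_root[OF pow_minus_var_closed] by auto
  then show "finite (pow_fixed n)"
    using finite_set_mset by metis
  have "size (roots (pow_minus_var n)) = card (pow_fixed n)"
    using count_roots_pow_minus_var[OF p] n
    by (simp add: size_multiset_overloaded_eq set_roots[unfolded n_def] n_def)
  moreover have "size (roots (pow_minus_var n)) = n"
    using roots_over_carrier[OF pow_minus_var_closed] degree_pow_minus_var[OF n]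
    by (simp add: splitted_def)
  ultimately show "card (pow_fixed n) = n" by simp
qed

lemma (in field) subfield_pow_fixed:
  assumes "prime_char_ring R p"
  shows "subfield (pow_fixed (p ^ m)) R"
proof (rule subfieldI'[OF subringI])
  interpret prime_char_ring R p by fact
  show "pow_fixed (p ^ m) \<subseteq> carrier R" "\<one> \<in> pow_fixed (p ^ m)"
    by (auto simp: pow_fixed_def)
  show "\<ominus> x \<in> pow_fixed (p ^ m)" if "x \<in> pow_fixed (p ^ m)" for x
    using that by (simp add: pow_fixed_def pow_prime_power_minus)
  show "x \<otimes> y \<in> pow_fixed (p ^ m)" "x \<oplus> y \<in> pow_fixed (p ^ m)"
    if "x \<in> pow_fixed (p ^ m)" "y \<in> pow_fixed (p ^ m)" for x y
    using that by (auto simp: pow_fixed_def pow_prime_power_add nat_pow_distrib)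
next
  fix x assume "x \<in> pow_fixed (p ^ m) - {\<zero>}"
  then have x: "x \<in> Units R" "x [^] (p ^ m) = x" by (auto simp: pow_fixed_def field_Units)
  have "x \<otimes> (inv x) [^] (p ^ m) = (x \<otimes> inv x) [^] (p ^ m)"
    by (subst nat_pow_distrib) (use x in \<open>simp_all add: Units_closed\<close>)
  also have "\<dots> = \<one>" using x by simp
  finally have "inv x = (inv x) [^] (p ^ m)"
    using x(1) by (intro comm_inv_char) auto
  then show "inv x \<in> pow_fixed (p ^ m)" using x(1) by (simp add: pow_fixed_def)
qed

lemma exists_algebraically_closed_of_prime_char:
  assumes "Factorial_Ring.prime p"
  shows "\<exists>L :: ((int list \<times> nat) multiset \<Rightarrow> int) ring. algebraically_closed L \<and> prime_char_ring L p"
proof -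
  define F where "F = residue_ring (int p)"
  interpret F: residues_prime p F
    using assms by unfold_locales (simp_all add: F_def)
  interpret F: field F by (rule F.is_field)
  define L where "L = F.alg_closure"
  interpret L: algebraic_closure L "F.indexed_const ` carrier F"
    unfolding L_def by (rule F.alg_closureE)
  interpret embed: ring_hom_ring F L F.indexed_const
    using F.alg_closureE(2) F.ring_axioms L.ring_axioms
    by (simp add: ring_hom_ringI2 L_def)
  have "[k] \<cdot>\<^bsub>F\<^esub> \<one>\<^bsub>F\<^esub> = int k mod int p" for k :: nat
    by (induction k) (auto simp: F.res_add_eq F.res_one_eq F.res_zero_eq mod_simps ac_simps)
  then have "prime_char_ring F p"
    using assms by unfold_locales (simp_all add: F.res_zero_eq)
  then show ?thesis
    using embed.prime_char_ring_codomain L.is_cring L.algebraically_closed_axioms L.field_axioms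
    by (auto simp: algebraically_closed_def)
qed

theorem exists_finite_field:
  fixes p m :: nat
  assumes "Factorial_Ring.prime p" "0 < m"
  shows "\<exists>K :: ((int list \<times> nat) multiset \<Rightarrow> int) ring.
    field K \<and> prime_char_ring K p \<and> finite (carrier K) \<and> card (carrier K) = p ^ m"
proof -
  obtain L :: "((int list \<times> nat) multiset \<Rightarrow> int) ring"
    where "algebraically_closed L" and L_char: "prime_char_ring L p"
    using exists_algebraically_closed_of_prime_char[OF assms(1)] by blast
  then interpret L: algebraically_closed L by simp
  let ?K = "L\<lparr>carrier := L.pow_fixed (p ^ m)\<rparr>"
  have "1 < p ^ m" using assms by (intro one_less_power prime_gt_1_nat)
  note card = L.card_pow_fixed[OF L_char this]
  have "field ?K" using L.subfield_pow_fixed[OF L_char] L.subfield_iff(2) by blast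
  then interpret K: field ?K .
  have "[k] \<cdot>\<^bsub>?K\<^esub> x = [k] \<cdot>\<^bsub>L\<^esub> x" for k :: nat and x
    by (simp add: add_pow_def nat_pow_def)
  then have "prime_char_ring ?K p"
    using assms(1) prime_char_ring.char_p[OF L_char] by unfold_locales simp_all
  then show ?thesis using \<open>field ?K\<close> card by (intro exI[of _ ?K]) simp
qed

section \<open>The field with \<open>q\<^sup>2\<close> elements\<close>

lemma (in abelian_subgroup) a_rcosets_minus_mem:
  assumes "B \<in> a_rcosets H" "x \<in> B" "y \<in> B"
  shows "x \<ominus> y \<in> H"
proof -
  obtain b where b: "b \<in> carrier G" "B = H +> b"
    using assms(1) by (auto simp: A_RCOSETS_def')
  then have y: "y \<in> carrier G" using a_elemrcos_carrier assms(3) by blast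
  have "x \<in> H +> y" using a_repr_independence' b assms(2,3) by blast
  then show ?thesis using a_rcos_module_imp[OF y] by (simp add: a_minus_def)
qed

lemma (in abelian_subgroup) a_rcosets_eqI:
  assumes "B \<in> a_rcosets H" "B' \<in> a_rcosets H" "x \<in> B" "x \<in> B'"
  shows "B = B'"
  using a_rcos_disjoint assms by (meson disjnt_iff pairwiseD)

lemma (in field) card_pow_eq_le:
  assumes "finite (carrier R)" "0 < d" "a \<in> carrier R" "a \<noteq> \<zero>"
  shows "card {x \<in> carrier R. x [^] (d::nat) = a} \<le> d"
proof (cases "{x \<in> carrier R. x [^] d = a} = {}")
  case False
  then obtain y where y: "y \<in> carrier R" "y [^] d = a" by blast
  then have "y \<noteq> \<zero>" using assms(2,4) nat_pow_zero by auto
  then have y_Units: "y \<in> Units R" using y(1) by (simp add: field_Units)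
  then have inv_y: "inv y \<noteq> \<zero>" using y(1) by (metis Units_r_inv one_not_zero r_null)
  have "inj_on (\<lambda>x. x \<otimes> inv y) {x \<in> carrier R. x [^] d = a}"
    using y_Units inv_y m_rcancel[of "inv y"] by (auto intro!: inj_onI)
  moreover have "(\<lambda>x. x \<otimes> inv y) ` {x \<in> carrier R. x [^] d = a} \<subseteq> {x \<in> carrier R. x [^] d = \<one>}"
  proof (clarify, intro conjI)
    fix x assume x: "x \<in> carrier R" "a = x [^] d"
    show "x \<otimes> inv y \<in> carrier R" using x(1) y_Units by simp
    have "(x \<otimes> inv y) [^] d = (y \<otimes> inv y) [^] d"
      using x y y_Units by (simp add: nat_pow_distrib del: Units_r_inv)
    then show "(x \<otimes> inv y) [^] d = \<one>" using y_Units by simp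
  qed
  ultimately have "card {x \<in> carrier R. x [^] d = a} \<le> card {x \<in> carrier R. x [^] d = \<one>}"
    using assms(1) by (intro card_inj_on_le) auto
  also have "\<dots> \<le> d" using num_roots_le_deg[OF assms(1)] assms(2) by simp
  finally show ?thesis .
qed (simp only: card.empty)

lemma (in field) pow_card_minus_one:
  assumes "finite (carrier R)" "x \<in> carrier R" "x \<noteq> \<zero>"
  shows "x [^] (card (carrier R) - 1) = \<one>"
proof -
  interpret G: group "Multiplicative_Group.mult_of R" by (rule field_mult_group)
  have "order (Multiplicative_Group.mult_of R) = card (carrier R) - 1"
    using assms(1) by (simp add: order_def carrier_mult_of card_Diff_singleton)
  then show ?thesis
    using G.pow_order_eq_1[of x] assms(2,3)
    by (simp add: carrier_mult_of Multiplicative_Group.nat_pow_mult_of one_mult_of)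
qed

locale quadratic_finite_field = field K for K (structure) +
  fixes q :: nat
  assumes q_gt_1: "1 < q"
    and finite_K: "finite (carrier K)" and card_K: "card (carrier K) = q\<^sup>2"
    and pow_q_add: "\<lbrakk>x \<in> carrier K; y \<in> carrier K\<rbrakk> \<Longrightarrow> (x \<oplus> y) [^] q = x [^] q \<oplus> y [^] q"
begin

definition field_norm :: "'a \<Rightarrow> 'a" where
  "field_norm x = x [^] q \<otimes> x"

definition unitary :: "'a set" where
  "unitary = {u \<in> carrier K. field_norm u = \<one>}"

definition eigenspace :: "'a \<Rightarrow> 'a set" where
  "eigenspace w = {t \<in> carrier K. t [^] q = w \<otimes> t}"

definition avoids_subfield :: "'a \<Rightarrow> 'a \<Rightarrow> bool" where
  "avoids_subfield a b \<longleftrightarrow> a \<in> carrier K \<and> b \<in> carrier K \<and> b \<noteq> \<zero> \<and>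
     (\<forall>u\<in>unitary. a \<oplus> b \<otimes> u \<notin> eigenspace \<one>)"

lemma zero_pow_q [simp]: "\<zero> [^] q = \<zero>"
  using q_gt_1 by (simp add: nat_pow_zero)

lemma pow_q_minus: "x \<in> carrier K \<Longrightarrow> (\<ominus> x) [^] q = \<ominus> (x [^] q)"
  using pow_q_add[of "\<ominus> x" x] by (simp add: l_neg minus_equality)

lemma pow_q_diff: "\<lbrakk>x \<in> carrier K; y \<in> carrier K\<rbrakk> \<Longrightarrow> (x \<ominus> y) [^] q = x [^] q \<ominus> y [^] q"
  by (simp add: a_minus_def pow_q_add pow_q_minus)

lemma q_square_minus_1: "q\<^sup>2 - 1 = (q + 1) * (q - 1)"
  by (simp add: power2_eq_square algebra_simps)

lemma pow_q_pow_q: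
  assumes "x \<in> carrier K"
  shows "(x [^] q) [^] q = x"
proof (cases "x = \<zero>")
  case False
  have "q\<^sup>2 = Suc (q\<^sup>2 - 1)" using q_gt_1 by simp
  then have "x [^] q\<^sup>2 = x [^] (q\<^sup>2 - 1) \<otimes> x" by (metis nat_pow_Suc)
  then show ?thesis
    using assms pow_card_minus_one[OF finite_K assms False] card_K
    by (simp add: nat_pow_pow power2_eq_square)
qed simp

lemma pow_q_inj: "\<lbrakk>x \<in> carrier K; y \<in> carrier K; x [^] q = y [^] q\<rbrakk> \<Longrightarrow> x = y"
  by (metis pow_q_pow_q)

lemma pow_q_eq_zero_iff: "x \<in> carrier K \<Longrightarrow> x [^] q = \<zero> \<longleftrightarrow> x = \<zero>"
  using pow_q_inj[of x \<zero>] by auto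

lemma field_norm_closed: "x \<in> carrier K \<Longrightarrow> field_norm x \<in> carrier K"
  by (simp add: field_norm_def)

lemma field_norm_eq_pow: "field_norm x = x [^] (q + 1)"
  by (simp add: field_norm_def)

lemma field_norm_eq_zero_iff: "x \<in> carrier K \<Longrightarrow> field_norm x = \<zero> \<longleftrightarrow> x = \<zero>"
  by (simp add: field_norm_def integral_iff pow_q_eq_zero_iff)

lemma field_norm_mult: "\<lbrakk>x \<in> carrier K; y \<in> carrier K\<rbrakk> \<Longrightarrow> field_norm (x \<otimes> y) = field_norm x \<otimes> field_norm y"
  by (simp add: field_norm_eq_pow nat_pow_distrib del: add_Suc_right)

lemma field_norm_minus: "x \<in> carrier K \<Longrightarrow> field_norm (\<ominus> x) = field_norm x"
  by (simp add: field_norm_def pow_q_minus l_minus r_minus)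

lemma field_norm_pow_q: "x \<in> carrier K \<Longrightarrow> field_norm (x [^] q) = field_norm x"
  by (simp add: field_norm_def pow_q_pow_q m_comm)

lemma unitaryD: "u \<in> unitary \<Longrightarrow> u \<in> carrier K" "u \<in> unitary \<Longrightarrow> field_norm u = \<one>"
  by (auto simp: unitary_def)

lemma unitary_nonzero: "u \<in> unitary \<Longrightarrow> u \<noteq> \<zero>"
  by (auto simp: unitary_def field_norm_def)

lemma unitary_one: "\<one> \<in> unitary"
  by (simp add: unitary_def field_norm_def)

lemma unitary_mult: "\<lbrakk>u \<in> unitary; w \<in> unitary\<rbrakk> \<Longrightarrow> u \<otimes> w \<in> unitary"
  by (simp add: unitary_def field_norm_mult)

lemma finite_unitary: "finite unitary"
  using finite_K by (simp add: unitary_def)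

lemma eigenspaceI: "\<lbrakk>t \<in> carrier K; t [^] q = w \<otimes> t\<rbrakk> \<Longrightarrow> t \<in> eigenspace w"
  by (simp add: eigenspace_def)

lemma eigenspaceD: "t \<in> eigenspace w \<Longrightarrow> t \<in> carrier K" "t \<in> eigenspace w \<Longrightarrow> t [^] q = w \<otimes> t"
  by (auto simp: eigenspace_def)

lemma abelian_subgroup_eigenspace:
  assumes "w \<in> carrier K"
  shows "abelian_subgroup (eigenspace w) K"
proof (intro abelian_subgroupI3 additive_subgroupI add.subgroupI)
  show "eigenspace w \<noteq> {}" using assms by (auto simp: eigenspace_def intro!: exI[of _ \<zero>])
qed (use assms in \<open>auto simp: eigenspace_def pow_q_add pow_q_minus r_distr r_minus abelian_group_axioms
      simp flip: a_inv_def\<close>)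

lemma eigenspace_iff_pow:
  assumes "t \<in> carrier K" "t \<noteq> \<zero>" "w \<in> carrier K"
  shows "t \<in> eigenspace w \<longleftrightarrow> t [^] (q - 1) = w"
proof -
  have "t [^] q = t [^] (q - 1) \<otimes> t" using q_gt_1 by (metis Suc_pred' nat_pow_Suc less_trans zero_less_one)
  then show ?thesis using assms m_rcancel[of t "t [^] (q - 1)" w] by (simp add: eigenspace_def)
qed

lemma eigenspace_eigenvalue_unique:
  assumes "t \<in> eigenspace w" "t \<in> eigenspace w'" "t \<noteq> \<zero>" "w \<in> carrier K" "w' \<in> carrier K"
  shows "w = w'"
  using assms eigenspace_iff_pow eigenspaceD(1) by blast

lemma eigenspace_quotient:
  assumes "f \<in> eigenspace w" "f \<noteq> \<zero>" "f \<otimes> g \<in> eigenspace w" "w \<in> carrier K" "g \<in> carrier K"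
  shows "g \<in> eigenspace \<one>"
proof -
  note f = eigenspaceD(1)[OF assms(1)]
  have "f [^] q \<otimes> g [^] q = w \<otimes> (f \<otimes> g)"
    using eigenspaceD(2)[OF assms(3)] f assms(5) by (simp add: nat_pow_distrib)
  also have "\<dots> = f [^] q \<otimes> g"
    using eigenspaceD(2)[OF assms(1)] f assms(4,5) by (simp add: m_assoc)
  finally have "g [^] q = g"
    using m_lcancel[of "f [^] q" "g [^] q" g] pow_q_eq_zero_iff[OF f] f assms(2,5) by simp
  then show ?thesis using assms(5) by (simp add: eigenspaceI)
qed

lemma pow_q_minus_1_unitary:
  assumes "t \<in> carrier K" "t \<noteq> \<zero>"
  shows "t [^] (q - 1) \<in> unitary"
  using pow_card_minus_one[OF finite_K assms] assms(1) q_square_minus_1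
  by (simp add: unitary_def field_norm_eq_pow nat_pow_pow card_K mult.commute del: add_Suc_right)

lemma finite_eigenspace: "finite (eigenspace w)"
  using finite_K by (simp add: eigenspace_def)

lemma card_norm_eq_le:
  assumes "a \<in> carrier K" "a \<noteq> \<zero>"
  shows "card {x \<in> carrier K. field_norm x = a} \<le> q + 1"
  unfolding field_norm_eq_pow using card_pow_eq_le[OF finite_K _ assms, of "q + 1"] by simp

lemma card_eigenspace_nonzero_le:
  assumes "w \<in> unitary"
  shows "card (eigenspace w - {\<zero>}) \<le> q - 1"
proof -
  note w = unitaryD(1)[OF assms] unitary_nonzero[OF assms]
  have "eigenspace w - {\<zero>} \<subseteq> {t \<in> carrier K. t [^] (q - 1) = w}"
    using eigenspace_iff_pow eigenspaceD(1) w(1) by blast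
  then have "card (eigenspace w - {\<zero>}) \<le> card {t \<in> carrier K. t [^] (q - 1) = w}"
    using finite_K by (intro card_mono) auto
  also have "\<dots> \<le> q - 1" using card_pow_eq_le[OF finite_K _ w] q_gt_1 by simp
  finally show ?thesis .
qed

lemma sum_card_eigenspace_nonzero: "(\<Sum>w\<in>unitary. card (eigenspace w - {\<zero>})) = (q + 1) * (q - 1)"
proof -
  have "t \<in> eigenspace (t [^] (q - 1))" if "t \<in> carrier K" "t \<noteq> \<zero>" for t
    using that eigenspace_iff_pow by simp
  then have "carrier K - {\<zero>} = (\<Union>w\<in>unitary. eigenspace w - {\<zero>})"
    using pow_q_minus_1_unitary eigenspaceD(1) by blast
  then have "card (carrier K - {\<zero>}) = card (\<Union>w\<in>unitary. eigenspace w - {\<zero>})" by simp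
  also have "\<dots> = (\<Sum>w\<in>unitary. card (eigenspace w - {\<zero>}))"
  proof (rule card_UN_disjoint)
    show "\<forall>w\<in>unitary. \<forall>w'\<in>unitary. w \<noteq> w' \<longrightarrow> (eigenspace w - {\<zero>}) \<inter> (eigenspace w' - {\<zero>}) = {}"
      using eigenspace_eigenvalue_unique unitaryD(1) by blast
  qed (use finite_unitary finite_eigenspace in auto)
  finally show ?thesis
    using card_K finite_K q_square_minus_1 by (simp add: card_Diff_singleton)
qed

lemma card_unitary: "card unitary = q + 1"
proof (rule antisym)
  show "card unitary \<le> q + 1" unfolding unitary_def by (rule card_norm_eq_le) simp_all
  have "(q + 1) * (q - 1) \<le> card unitary * (q - 1)"
    using sum_bounded_above[of unitary "\<lambda>w. card (eigenspace w - {\<zero>})" "q - 1"]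
      card_eigenspace_nonzero_le sum_card_eigenspace_nonzero by simp
  then show "q + 1 \<le> card unitary" using q_gt_1 by (simp only: mult_le_cancel2)
qed

lemma card_eigenspace_nonzero:
  assumes "w \<in> unitary"
  shows "card (eigenspace w - {\<zero>}) = q - 1"
proof (rule ccontr)
  assume "card (eigenspace w - {\<zero>}) \<noteq> q - 1"
  then have "card (eigenspace w - {\<zero>}) < q - 1" using card_eigenspace_nonzero_le[OF assms] by simp
  then have "(\<Sum>w\<in>unitary. card (eigenspace w - {\<zero>})) < (\<Sum>w\<in>unitary. q - 1)"
    using assms card_eigenspace_nonzero_le finite_unitary by (intro sum_strict_mono_ex1) blast+
  then show False using sum_card_eigenspace_nonzero card_unitary by simp
qed

lemma card_eigenspace:
  assumes "w \<in> unitary"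
  shows "card (eigenspace w) = q"
proof -
  interpret abelian_subgroup "eigenspace w" K
    by (rule abelian_subgroup_eigenspace[OF unitaryD(1)[OF assms]])
  show ?thesis
    using card_eigenspace_nonzero[OF assms] q_gt_1 by (simp add: card_Diff_singleton)
qed

lemma finite_cosets: "finite (a_rcosets (eigenspace w))"
  using finite_K by (simp add: A_RCOSETS_def')

lemma card_coset:
  assumes "w \<in> unitary" "B \<in> a_rcosets (eigenspace w)"
  shows "card B = q"
  using a_card_cosets_equal[OF assms(2)] abelian_subgroup_eigenspace card_eigenspace[OF assms(1)]
    finite_K by (metis eigenspaceD(1) subsetI)

lemma card_cosets:
  assumes "w \<in> unitary"
  shows "card (a_rcosets (eigenspace w)) = q"
proof -
  interpret abelian_subgroup "eigenspace w" K
    by (rule abelian_subgroup_eigenspace[OF unitaryD(1)[OF assms]])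
  have "card (a_rcosets (eigenspace w)) * q = q * q"
    using a_lagrange[OF finite_K is_additive_subgroup] card_eigenspace[OF assms] card_K
    by (simp add: order_def power2_eq_square)
  then show ?thesis using q_gt_1 by simp
qed

lemma exists_norm_notin:
  assumes "finite A" "A \<subseteq> carrier K" "card A < q - 1"
  obtains b where "b \<in> carrier K" "b \<noteq> \<zero>" "field_norm b \<notin> A"
proof (rule ccontr)
  let ?fibre = "\<lambda>a. {x \<in> carrier K. field_norm x = a}"
  assume "\<not> thesis"
  then have "carrier K - {\<zero>} \<subseteq> (\<Union>a\<in>A - {\<zero>}. ?fibre a)"
    using that field_norm_eq_zero_iff by auto
  then have "card (carrier K - {\<zero>}) \<le> card (\<Union>a\<in>A - {\<zero>}. ?fibre a)"
    using assms(1) finite_K by (intro card_mono) auto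
  also have "\<dots> \<le> (\<Sum>a\<in>A - {\<zero>}. card (?fibre a))"
    using assms(1) by (intro card_UN_le) simp
  also have "\<dots> \<le> card (A - {\<zero>}) * (q + 1)"
    using sum_bounded_above[of "A - {\<zero>}" "\<lambda>a. card (?fibre a)" "q + 1"] card_norm_eq_le assms(2) by auto
  also have "\<dots> \<le> card A * (q + 1)" using assms(1) by (intro mult_right_mono card_mono) auto
  also have "\<dots> < (q - 1) * (q + 1)" using assms(3) by (simp only: mult_less_cancel2) simp
  finally show False
    using card_K finite_K q_square_minus_1 by (simp add: card_Diff_singleton mult.commute)
qed

lemma avoids_subfield_if_norm_misses_value:
  assumes a: "a \<in> carrier K" and card: "card (field_norm ` ((eigenspace \<one> +> a) - {\<zero>})) < q - 1"
  shows "\<exists>b. avoids_subfield a b"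
proof -
  interpret F: abelian_subgroup "eigenspace \<one>" K by (simp add: abelian_subgroup_eigenspace)
  have subset: "eigenspace \<one> +> a \<subseteq> carrier K" using a_r_coset_subset_G F.a_subset a by blast
  then have "field_norm ` ((eigenspace \<one> +> a) - {\<zero>}) \<subseteq> carrier K" using field_norm_closed by blast
  moreover have "finite (field_norm ` ((eigenspace \<one> +> a) - {\<zero>}))"
    using subset finite_K finite_subset by blast
  ultimately obtain b where b: "b \<in> carrier K" "b \<noteq> \<zero>" "field_norm b \<notin> field_norm ` ((eigenspace \<one> +> a) - {\<zero>})"
    using exists_norm_notin card by blast
  have "a \<oplus> b \<otimes> u \<notin> eigenspace \<one>" if u: "u \<in> unitary" for u
  proof
    note closed = a b(1) unitaryD(1)[OF u]
    assume "a \<oplus> b \<otimes> u \<in> eigenspace \<one>"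
    then have "\<ominus> (a \<oplus> b \<otimes> u) \<oplus> a \<in> eigenspace \<one> +> a"
      using F.a_inv_closed a_rcosI[OF _ F.a_subset a] by blast
    moreover have "\<ominus> (a \<oplus> b \<otimes> u) \<oplus> a = \<ominus> (b \<otimes> u)" using closed by algebra
    moreover have norm_eq: "field_norm (\<ominus> (b \<otimes> u)) = field_norm b"
      using closed unitaryD(2)[OF u] by (simp add: field_norm_minus field_norm_mult field_norm_closed)
    moreover have "\<ominus> (b \<otimes> u) \<noteq> \<zero>"
      using norm_eq field_norm_eq_zero_iff closed b(2) by (metis zero_closed)
    ultimately show False using b(3) by (metis Diff_iff empty_iff image_eqI insert_iff)
  qed
  then show ?thesis using a b by (auto simp: avoids_subfield_def)
qed

lemma exists_avoids_subfield_odd: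
  assumes "\<ominus> \<one> \<noteq> \<one>"
  shows "\<exists>a b. avoids_subfield a b"
proof -
  interpret F: abelian_subgroup "eigenspace \<one>" K by (simp add: abelian_subgroup_eigenspace)
  let ?S = "eigenspace \<one> - {\<zero>}"
  have one: "\<one> \<in> ?S" by (simp add: eigenspaceI)
  moreover have "\<ominus> \<one> \<noteq> \<zero>" using r_neg[of \<one>] by (metis one_closed one_not_zero r_zero)
  ultimately have "\<ominus> \<one> \<in> ?S - {\<one>}" using F.a_inv_closed[of \<one>] assms by simp
  moreover have "field_norm \<one> = field_norm (\<ominus> \<one>)" by (simp add: field_norm_minus)
  ultimately have "field_norm ` ?S = field_norm ` (?S - {\<one>})" using one by blast
  then have "card (field_norm ` ?S) \<le> card (?S - {\<one>})"
    using finite_eigenspace by (simp add: card_image_le)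
  also have "\<dots> < card ?S" using one finite_eigenspace by (intro card_Diff1_less) auto
  finally have "card (field_norm ` ((eigenspace \<one> +> \<zero>) - {\<zero>})) < q - 1"
    using card_eigenspace_nonzero[OF unitary_one] F.a_subset by simp
  then show ?thesis using avoids_subfield_if_norm_misses_value by blast
qed

lemma pow_q_mem_coset_of_subfield:
  assumes char_2: "\<ominus> \<one> = \<one>" and C: "C \<in> a_rcosets (eigenspace \<one>)" "C \<noteq> eigenspace \<one>" and "x \<in> C"
  shows "x [^] q \<in> C" "x [^] q \<noteq> x"
proof -
  interpret F: abelian_subgroup "eigenspace \<one>" K by (simp add: abelian_subgroup_eigenspace)
  have x: "x \<in> carrier K" using F.a_rcosets_carrier[OF C(1)] \<open>x \<in> C\<close> by blast
  have "(x [^] q \<ominus> x) [^] q = x \<ominus> x [^] q"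
    using x by (simp add: pow_q_diff pow_q_pow_q)
  also have "\<dots> = \<ominus> \<one> \<otimes> (x [^] q \<ominus> x)"
    using x nat_pow_closed[OF x, of q] by algebra
  finally have "x [^] q \<ominus> x \<in> eigenspace \<one>"
    using x unfolding char_2 by (intro eigenspaceI) simp_all
  then have "x [^] q \<in> eigenspace \<one> +> x"
    using F.a_rcos_module_minus[OF ring_axioms x] x by simp
  moreover have "eigenspace \<one> +> x = C"
    using F.a_rcosets_eqI[OF a_rcosetsI[OF F.a_subset x] C(1) F.a_rcos_self[OF x] \<open>x \<in> C\<close>] .
  ultimately show "x [^] q \<in> C" by simp
  have "x \<notin> eigenspace \<one>"
    using F.a_rcosets_eqI[OF C(1) F.a_subgroup_in_rcosets \<open>x \<in> C\<close>] C(2) by blast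
  then show "x [^] q \<noteq> x" using x by (auto intro: eigenspaceI)
qed

text \<open>On a coset of the subfield, \<open>x \<mapsto> x^q\<close> permutes the elements of equal norm without fixed
  points, so two elements can be dropped without losing a value of the norm.\<close>

lemma exists_avoids_subfield_even:
  assumes "\<ominus> \<one> = \<one>" "2 < q"
  shows "\<exists>a b. avoids_subfield a b"
proof -
  interpret F: abelian_subgroup "eigenspace \<one>" K by (simp add: abelian_subgroup_eigenspace)
  have "eigenspace \<one> \<noteq> carrier K"
    using card_eigenspace[OF unitary_one] card_K \<open>2 < q\<close> by (auto simp: power2_eq_square)
  then obtain a where a: "a \<in> carrier K" "a \<notin> eigenspace \<one>" using F.a_subset by blast
  let ?C = "eigenspace \<one> +> a"
  have C: "?C \<in> a_rcosets (eigenspace \<one>)" using a(1) by (simp add: a_rcosetsI F.a_subset)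
  have a_C: "a \<in> ?C" using F.a_rcos_self[OF a(1)] .
  then have "?C \<noteq> eigenspace \<one>" using a(2) by blast
  note pow_C = pow_q_mem_coset_of_subfield[OF assms(1) C this]
  note C_carrier = subsetD[OF F.a_rcosets_carrier[OF C]]
  have finite_C: "finite ?C" using finite_subset[OF F.a_rcosets_carrier[OF C] finite_K] .
  have card_C: "card ?C = q" using card_coset[OF unitary_one C] .
  have "card {a, a [^] q} \<le> 2" by (simp add: card_insert_if)
  then have "\<not> ?C \<subseteq> {a, a [^] q}"
    using card_mono[of "{a, a [^] q}" ?C] card_C \<open>2 < q\<close> by force
  then obtain x where x: "x \<in> ?C" "x \<noteq> a" "x \<noteq> a [^] q" by blast
  have "x [^] q \<noteq> a" using x(3) pow_q_pow_q[OF C_carrier[OF x(1)]] by auto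
  then have "a [^] q \<in> ?C - {a, x}" "x [^] q \<in> ?C - {a, x}"
    using pow_C[OF a_C] pow_C[OF x(1)] x(3) by simp_all
  moreover have "field_norm a = field_norm (a [^] q)" "field_norm x = field_norm (x [^] q)"
    using field_norm_pow_q C_carrier a_C x(1) by simp_all
  ultimately have "field_norm ` ?C = field_norm ` (?C - {a, x})" by blast
  then have "card (field_norm ` (?C - {\<zero>})) \<le> card (field_norm ` (?C - {a, x}))"
    using finite_C by (metis Diff_subset card_mono finite_imageI image_mono)
  also have "\<dots> \<le> card (?C - {a, x})" using finite_C by (intro card_image_le) simp
  also have "\<dots> < q - 1" using a_C x \<open>2 < q\<close> by (subst card_Diff_subset) (auto simp: card_C)
  finally show ?thesis using avoids_subfield_if_norm_misses_value a(1) by blast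
qed

lemma exists_avoids_subfield: "2 < q \<Longrightarrow> \<exists>a b. avoids_subfield a b"
  using exists_avoids_subfield_odd exists_avoids_subfield_even by blast

end

section \<open>A parallelism of \<open>PG(3,q)\<close> for \<open>q > 2\<close>\<close>

datatype 'a point = At_Infinity 'a | Affine 'a 'a

datatype 'a spread_index = Regular | Derived 'a "'a set"

datatype 'a plane_point = Direction 'a | Position 'a

locale avoiding_pair = quadratic_finite_field +
  fixes a b
  assumes avoids: "avoids_subfield a b"
begin

definition height :: "'a \<Rightarrow> 'a \<Rightarrow> 'a \<Rightarrow> 'a \<Rightarrow> 'a" where
  "height w f s u = s \<oplus> f \<otimes> (a \<oplus> b \<otimes> (u \<otimes> w))"

definition graph :: "('a \<Rightarrow> 'a) \<Rightarrow> 'a point set" where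
  "graph g = (\<lambda>u. Affine u (g u)) ` unitary"

definition coset_line :: "'a \<Rightarrow> 'a set \<Rightarrow> 'a \<Rightarrow> 'a point set" where
  "coset_line w B u = insert (At_Infinity (u \<otimes> w)) (Affine u ` B)"

definition points :: "'a point set" where
  "points = At_Infinity ` unitary \<union> (\<lambda>(u, z). Affine u z) ` (unitary \<times> carrier K)"

definition indices :: "'a spread_index set" where
  "indices = insert Regular ((\<lambda>(w, B). Derived w B) ` (SIGMA w:unitary. a_rcosets (eigenspace w)))"

fun spread :: "'a spread_index \<Rightarrow> 'a point set set" where
  "spread Regular = insert (At_Infinity ` unitary) ((\<lambda>z. graph (\<lambda>_. z)) ` carrier K)"
| "spread (Derived w B) = coset_line w B ` unitary \<union>
     (\<lambda>(f, s). graph (height w f s)) ` ((eigenspace w - {\<zero>}) \<times> B)"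

text \<open>\<open>Derived w B\<close> is matched with the line \<open>B\<close> of the affine plane \<open>carrier K\<close>, and \<open>Regular\<close> with
  the line at infinity.\<close>

definition plane_points :: "'a plane_point set" where
  "plane_points = Direction ` unitary \<union> Position ` carrier K"

fun plane_line :: "'a spread_index \<Rightarrow> 'a plane_point set" where
  "plane_line Regular = Direction ` unitary"
| "plane_line (Derived w B) = insert (Direction w) (Position ` B)"

definition joined :: "'a spread_index \<Rightarrow> 'a point \<Rightarrow> 'a point \<Rightarrow> bool" where
  "joined k x y \<longleftrightarrow> k \<in> indices \<and> (\<exists>L\<in>spread k. x \<in> L \<and> y \<in> L)"

lemma ab_closed: "a \<in> carrier K" "b \<in> carrier K"
  and b_nonzero: "b \<noteq> \<zero>"
  and notin_subfield: "u \<in> unitary \<Longrightarrow> a \<oplus> b \<otimes> u \<notin> eigenspace \<one>"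
  using avoids by (auto simp: avoids_subfield_def)

lemma Derived_in_indices_iff:
  "Derived w B \<in> indices \<longleftrightarrow> w \<in> unitary \<and> B \<in> a_rcosets (eigenspace w)"
  by (auto simp: indices_def)

lemma Derived_indexD:
  assumes "Derived w B \<in> indices"
  shows "w \<in> unitary" "w \<in> carrier K" "w \<noteq> \<zero>" "B \<in> a_rcosets (eigenspace w)"
    and "abelian_subgroup (eigenspace w) K"
  using assms unitaryD(1) unitary_nonzero abelian_subgroup_eigenspace
  by (auto simp: Derived_in_indices_iff)

lemma index_set_closed:
  assumes "Derived w B \<in> indices" "x \<in> B"
  shows "x \<in> carrier K"
  using abelian_subgroup.a_rcosets_carrier[OF Derived_indexD(5,4)[OF assms(1)]] assms(2) by blast

lemma index_set_diff:
  assumes "Derived w B \<in> indices" "x \<in> B" "y \<in> B"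
  shows "x \<ominus> y \<in> eigenspace w"
  using abelian_subgroup.a_rcosets_minus_mem[OF Derived_indexD(5,4)[OF assms(1)] assms(2,3)] .

lemma index_set_eqI:
  assumes "Derived w B \<in> indices" "Derived w B' \<in> indices" "x \<in> B" "x \<in> B'"
  shows "B = B'"
  using abelian_subgroup.a_rcosets_eqI[OF Derived_indexD(5,4)[OF assms(1)] Derived_indexD(4)[OF assms(2)]]
    assms(3,4) .

lemma Derived_eqI:
  assumes "Derived w B \<in> indices" "Derived w' B' \<in> indices" "x \<noteq> y" "x \<in> B" "y \<in> B" "x \<in> B'" "y \<in> B'"
  shows "Derived w B = Derived w' B'"
proof -
  have "x \<ominus> y \<noteq> \<zero>" using assms index_set_closed by simp
  then have "w = w'"
    using eigenspace_eigenvalue_unique[of "x \<ominus> y" w w'] assms index_set_diff Derived_indexD(2) by blast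
  then show ?thesis using index_set_eqI assms by blast
qed

lemma height_closed:
  "\<lbrakk>w \<in> carrier K; f \<in> carrier K; s \<in> carrier K; u \<in> carrier K\<rbrakk> \<Longrightarrow> height w f s u \<in> carrier K"
  by (simp add: height_def ab_closed)

lemma eigenspace_mult_notin:
  assumes "w \<in> unitary" "u \<in> unitary" "f \<in> eigenspace w" "f \<noteq> \<zero>"
  shows "f \<otimes> (a \<oplus> b \<otimes> (u \<otimes> w)) \<notin> eigenspace w"
  using eigenspace_quotient[of f w "a \<oplus> b \<otimes> (u \<otimes> w)"] notin_subfield[of "u \<otimes> w"] assms
    unitary_mult unitaryD(1) ab_closed by auto

lemma height_notin_index_set:
  assumes k: "Derived w B \<in> indices" and "u \<in> unitary" "f \<in> eigenspace w" "f \<noteq> \<zero>" "s \<in> B"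
  shows "height w f s u \<notin> B"
proof
  assume "height w f s u \<in> B"
  then have "height w f s u \<ominus> s \<in> eigenspace w" using index_set_diff[OF k] assms(5) by blast
  moreover have "height w f s u \<ominus> s = f \<otimes> (a \<oplus> b \<otimes> (u \<otimes> w))"
    using Derived_indexD(2)[OF k] unitaryD(1)[OF assms(2)] eigenspaceD(1)[OF assms(3)]
      index_set_closed[OF k assms(5)] ab_closed unfolding height_def by algebra
  ultimately show False using eigenspace_mult_notin Derived_indexD(1)[OF k] assms(2-4) by simp
qed

lemma height_parameters_unique:
  assumes k: "Derived w B \<in> indices" and u: "u \<in> unitary"
    and f: "f \<in> eigenspace w" "f' \<in> eigenspace w" and s: "s \<in> B" "s' \<in> B"
    and eq: "height w f s u = height w f' s' u"
  shows "f = f'" "s = s'"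
proof -
  define g where "g = a \<oplus> b \<otimes> (u \<otimes> w)"
  have closed: "s \<in> carrier K" "s' \<in> carrier K" "f \<in> carrier K" "f' \<in> carrier K" "g \<in> carrier K"
    using s f index_set_closed[OF k] eigenspaceD(1) unitaryD(1)[OF u] Derived_indexD(2)[OF k] ab_closed
    by (auto simp: g_def)
  have eq': "s \<oplus> f \<otimes> g = s' \<oplus> f' \<otimes> g" using eq by (simp add: height_def g_def)
  have "(f \<ominus> f') \<otimes> g = s' \<ominus> s \<oplus> ((s \<oplus> f \<otimes> g) \<ominus> (s' \<oplus> f' \<otimes> g))"
    using closed by algebra
  then have "(f \<ominus> f') \<otimes> g = s' \<ominus> s"
    unfolding eq' using closed by (simp add: a_minus_def r_neg)
  then have "(f \<ominus> f') \<otimes> g \<in> eigenspace w"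
    using index_set_diff[OF k s(2,1)] by simp
  moreover have "f \<ominus> f' \<in> eigenspace w"
    using additive_subgroup.a_closed additive_subgroup.a_inv_closed f Derived_indexD(5)[OF k]
    unfolding a_minus_def abelian_subgroup_def by metis
  ultimately have "f \<ominus> f' = \<zero>"
    using eigenspace_mult_notin[OF Derived_indexD(1)[OF k] u] by (auto simp: g_def)
  then show "f = f'" using closed by simp
  then show "s = s'" using eq' closed by simp
qed

lemma height_diff:
  assumes "w \<in> carrier K" "u \<in> carrier K" "u' \<in> carrier K" "f \<in> eigenspace w" "s \<in> carrier K"
  shows "height w f s u \<ominus> height w f s u' = f [^] q \<otimes> (b \<otimes> (u \<ominus> u'))"
  using assms(1-3,5) eigenspaceD(1)[OF assms(4)] ab_closed
  unfolding height_def eigenspaceD(2)[OF assms(4)] by algebra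

lemma inj_on_height:
  assumes "w \<in> carrier K" "f \<in> eigenspace w" "f \<noteq> \<zero>" "s \<in> carrier K"
  shows "inj_on (height w f s) (carrier K)"
proof (rule inj_onI)
  note f = eigenspaceD(1)[OF assms(2)]
  fix u u' assume u: "u \<in> carrier K" "u' \<in> carrier K" and eq: "height w f s u = height w f s u'"
  have "f [^] q \<otimes> (b \<otimes> (u \<ominus> u')) = \<zero>"
    using height_diff[OF assms(1) u assms(2,4)] height_closed[OF assms(1) f assms(4) u(2)]
    unfolding eq by (simp add: a_minus_def r_neg)
  moreover have "f [^] q \<noteq> \<zero>" using assms(3) pow_q_eq_zero_iff[OF f] by simp
  ultimately show "u = u'" using u f ab_closed b_nonzero by (simp add: integral_iff)
qed

text \<open>The increment \<open>f^q b (u - u')\<close> between two points of a graph determines \<open>f\<close> and hence \<open>w\<close>.\<close>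

lemma height_determined_by_two_values:
  assumes w: "w \<in> carrier K" "w' \<in> carrier K"
    and f: "f \<in> eigenspace w" "f \<noteq> \<zero>" "f' \<in> eigenspace w'"
    and s: "s \<in> carrier K" "s' \<in> carrier K"
    and u: "u \<in> carrier K" "u' \<in> carrier K" "u \<noteq> u'"
    and eq: "height w f s u = height w' f' s' u" "height w f s u' = height w' f' s' u'"
  shows "w = w'" "s = s'"
proof -
  note closed = eigenspaceD(1)[OF f(1)] eigenspaceD(1)[OF f(3)]
  have "f [^] q \<otimes> (b \<otimes> (u \<ominus> u')) = f' [^] q \<otimes> (b \<otimes> (u \<ominus> u'))"
    using height_diff[OF w(1) u(1,2) f(1) s(1)] height_diff[OF w(2) u(1,2) f(3) s(2)] eq by simp
  moreover have "b \<otimes> (u \<ominus> u') \<noteq> \<zero>" using u ab_closed b_nonzero by (simp add: integral_iff)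
  ultimately have "f [^] q = f' [^] q" using closed u ab_closed by (simp add: m_rcancel)
  then have "f = f'" using closed by (simp add: pow_q_inj)
  then show "w = w'" using eigenspace_eigenvalue_unique f w by blast
  then show "s = s'"
    using eq(1) \<open>f = f'\<close> closed s u(1) w(1) ab_closed by (simp add: height_def)
qed

lemma joined_At_Infinity_At_Infinity:
  assumes "joined k (At_Infinity v) (At_Infinity v')" "v \<noteq> v'"
  shows "k = Regular"
  using assms by (cases k) (auto simp: joined_def graph_def coset_line_def)

lemma joined_At_Infinity_Affine:
  assumes "joined k (At_Infinity v) (Affine u z)"
  obtains w B where "k = Derived w B" "Derived w B \<in> indices" "u \<in> unitary" "v = u \<otimes> w" "z \<in> B"
  using assms by (cases k) (auto simp: joined_def graph_def coset_line_def)

lemma joined_Affine_same: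
  assumes "joined k (Affine u z) (Affine u z')" "z \<noteq> z'"
  obtains w B where "k = Derived w B" "Derived w B \<in> indices" "z \<in> B" "z' \<in> B"
  using assms by (cases k) (auto simp: joined_def graph_def coset_line_def)

lemma joined_Affine_different:
  assumes "joined k (Affine u z) (Affine u' z')" "u \<noteq> u'"
  obtains (regular) "k = Regular" "z = z'"
  | (derived) w B f s where "k = Derived w B" "Derived w B \<in> indices" "f \<in> eigenspace w" "f \<noteq> \<zero>" "s \<in> B"
      "u \<in> unitary" "u' \<in> unitary" "z = height w f s u" "z' = height w f s u'" "z \<noteq> z'"
proof (cases k)
  case Regular
  then show ?thesis using assms regular by (auto simp: joined_def graph_def)
next
  case (Derived w B)
  have k: "Derived w B \<in> indices" using assms(1) Derived by (simp add: joined_def)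
  obtain f s where f: "f \<in> eigenspace w" "f \<noteq> \<zero>" "s \<in> B"
    and u: "u \<in> unitary" "u' \<in> unitary" "z = height w f s u" "z' = height w f s u'"
    using assms Derived by (auto simp: joined_def coset_line_def graph_def)
  have "z \<noteq> z'"
    using inj_onD[OF inj_on_height[OF Derived_indexD(2)[OF k] f(1,2) index_set_closed[OF k f(3)]]]
      u unitaryD(1) assms(2) by blast
  then show ?thesis using derived[OF Derived k f u] by simp
qed

lemma joined_commute: "joined k x y \<longleftrightarrow> joined k y x"
  by (auto simp: joined_def)

lemma joined_At_Infinity_Affine_unique:
  assumes "joined k (At_Infinity v) (Affine u z)" "joined k' (At_Infinity v) (Affine u z)"
  shows "k = k'"
proof -
  obtain w B where k: "k = Derived w B" "Derived w B \<in> indices" "u \<in> unitary" "v = u \<otimes> w" "z \<in> B"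
    using joined_At_Infinity_Affine[OF assms(1)] .
  obtain w' B' where k': "k' = Derived w' B'" "Derived w' B' \<in> indices" "v = u \<otimes> w'" "z \<in> B'"
    using joined_At_Infinity_Affine[OF assms(2)] .
  have "w = w'"
    using k(4) k'(3) unitary_nonzero[OF k(3)] unitaryD(1)[OF k(3)] Derived_indexD(2) k(2) k'(2)
    by (metis m_lcancel)
  then show ?thesis using k k' index_set_eqI by blast
qed

lemma joined_Affine_same_unique:
  assumes "joined k (Affine u z) (Affine u z')" "joined k' (Affine u z) (Affine u z')" "z \<noteq> z'"
  shows "k = k'"
proof -
  obtain w B where "k = Derived w B" "Derived w B \<in> indices" "z \<in> B" "z' \<in> B"
    using joined_Affine_same[OF assms(1,3)] .
  moreover obtain w' B' where "k' = Derived w' B'" "Derived w' B' \<in> indices" "z \<in> B'" "z' \<in> B'"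
    using joined_Affine_same[OF assms(2,3)] .
  ultimately show ?thesis using Derived_eqI[OF _ _ assms(3)] by simp
qed

lemma joined_Affine_different_unique:
  assumes joined: "joined k (Affine u z) (Affine u' z')" "joined k' (Affine u z) (Affine u' z')"
    and "u \<noteq> u'"
  shows "k = k'"
proof -
  from joined(1) \<open>u \<noteq> u'\<close> show ?thesis
  proof (cases rule: joined_Affine_different)
    case regular
    with joined(2) \<open>u \<noteq> u'\<close> show ?thesis by (elim joined_Affine_different) simp_all
  next
    case k: (derived w B f s)
    from joined(2) \<open>u \<noteq> u'\<close> show ?thesis
    proof (cases rule: joined_Affine_different)
      case regular
      with k show ?thesis by simp
    next
      case k': (derived w' B' f' s')
      have "w = w'" "s = s'"
        using height_determined_by_two_values[of w w' f f' s s' u u'] k k' \<open>u \<noteq> u'\<close>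
          Derived_indexD(2) index_set_closed unitaryD(1) by metis+
      then show ?thesis using k k' index_set_eqI by blast
    qed
  qed
qed

lemma joined_unique:
  assumes "joined k x y" "joined k' x y" "x \<noteq> y"
  shows "k = k'"
proof (cases x; cases y)
  fix v v' assume "x = At_Infinity v" "y = At_Infinity v'"
  then show ?thesis using assms joined_At_Infinity_At_Infinity by metis
next
  fix v u z assume "x = At_Infinity v" "y = Affine u z"
  then show ?thesis using assms joined_At_Infinity_Affine_unique by blast
next
  fix u z v assume "x = Affine u z" "y = At_Infinity v"
  then show ?thesis
    using assms joined_At_Infinity_Affine_unique[of k v u z k'] by (simp add: joined_commute)
next
  fix u z u' z' assume xy: "x = Affine u z" "y = Affine u' z'"
  show ?thesis
  proof (cases "u = u'")
    case True
    then have "z \<noteq> z'" using xy assms(3) by blast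
    then show ?thesis using xy True assms(1,2) joined_Affine_same_unique by blast
  next
    case False
    then show ?thesis using xy assms joined_Affine_different_unique by blast
  qed
qed

lemma coset_line_unique:
  assumes "Derived w B \<in> indices" "u \<in> unitary" "u' \<in> unitary"
    and "x \<in> coset_line w B u" "x \<in> coset_line w B u'"
  shows "u = u'"
  using assms Derived_indexD(2,3)[OF assms(1)] unitaryD(1) by (auto simp: coset_line_def m_rcancel)

lemma graph_height_unique:
  assumes "Derived w B \<in> indices" "f \<in> eigenspace w" "f' \<in> eigenspace w" "s \<in> B" "s' \<in> B"
    and "x \<in> graph (height w f s)" "x \<in> graph (height w f' s')"
  shows "f = f' \<and> s = s'"
  using assms height_parameters_unique[OF assms(1)] by (auto simp: graph_def)

lemma spread_disjoint:
  assumes k: "k \<in> indices" and L: "L \<in> spread k" "L' \<in> spread k" "x \<in> L" "x \<in> L'"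
  shows "L = L'"
proof (cases k)
  case Regular
  then show ?thesis using L by (auto simp: graph_def)
next
  case (Derived w B)
  note k = k[unfolded Derived]
  have coset_graph: False
    if "f \<in> eigenspace w" "f \<noteq> \<zero>" "s \<in> B" "x \<in> coset_line w B u" "x \<in> graph (height w f s)" for u f s
    using that height_notin_index_set[OF k] by (auto simp: coset_line_def graph_def)
  show ?thesis
    using L unfolding Derived
    by (auto dest: coset_graph coset_line_unique[OF k] graph_height_unique[OF k])
qed

lemma finite_points: "finite points"
  using finite_unitary finite_K by (simp add: points_def)

lemma card_points: "card points = (q + 1) * (q\<^sup>2 + 1)"
proof -
  have "card (At_Infinity ` unitary) = q + 1"
    using card_unitary by (simp add: card_image inj_on_def)
  moreover have "card ((\<lambda>(u, z). Affine u z) ` (unitary \<times> carrier K)) = (q + 1) * q\<^sup>2"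
    using card_unitary card_K by (simp add: card_image inj_on_def card_cartesian_product)
  ultimately show ?thesis
    unfolding points_def using finite_unitary finite_K by (subst card_Un_disjoint) auto
qed

lemma finite_indices: "finite indices"
  using finite_unitary finite_cosets by (simp add: indices_def)

lemma card_indices: "card indices = q\<^sup>2 + q + 1"
proof -
  have "card ((\<lambda>(w, B). Derived w B) ` (SIGMA w:unitary. a_rcosets (eigenspace w))) = (q + 1) * q"
    using card_Sigma_const[OF finite_unitary finite_cosets card_cosets] card_unitary
    by (subst card_image) (auto simp: inj_on_def)
  then show ?thesis
    unfolding indices_def using finite_unitary finite_cosets
    by (subst card_insert_disjoint) (auto simp: power2_eq_square)
qed

lemma card_graph: "card (graph g) = q + 1"
  unfolding graph_def using card_unitary by (subst card_image) (auto simp: inj_on_def)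

lemma finite_index_set: "Derived w B \<in> indices \<Longrightarrow> finite B"
  using index_set_closed finite_K by (meson finite_subset subsetI)

lemma card_index_set: "Derived w B \<in> indices \<Longrightarrow> card B = q"
  using card_coset[of w B] by (simp add: Derived_in_indices_iff)

lemma card_coset_line:
  assumes "Derived w B \<in> indices"
  shows "card (coset_line w B u) = q + 1"
proof -
  have "card (Affine u ` B) = q"
    using card_index_set[OF assms] by (simp add: card_image inj_on_def)
  then show ?thesis
    unfolding coset_line_def using finite_index_set[OF assms] by (subst card_insert_disjoint) auto
qed

lemma card_in_spread:
  assumes "k \<in> indices" "L \<in> spread k"
  shows "card L = q + 1"
  using assms card_unitary card_graph card_coset_line
  by (cases k) (auto simp: card_image inj_on_def)

lemma spread_subset:
  assumes "k \<in> indices" "L \<in> spread k"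
  shows "L \<subseteq> points"
proof (cases k)
  case Regular
  then show ?thesis using assms by (auto simp: points_def graph_def)
next
  case (Derived w B)
  note k = assms(1)[unfolded Derived]
  note closed = Derived_indexD(1,2)[OF k] index_set_closed[OF k]
  show ?thesis
    using assms(2) closed height_closed eigenspaceD(1) unitaryD(1) unitary_mult
    by (auto simp: Derived points_def graph_def coset_line_def)
qed

lemma card_spread_Derived:
  assumes k: "Derived w B \<in> indices"
  shows "card (spread (Derived w B)) = q\<^sup>2 + 1"
proof -
  let ?cosets = "coset_line w B ` unitary"
  let ?graphs = "(\<lambda>(f, s). graph (height w f s)) ` ((eigenspace w - {\<zero>}) \<times> B)"
  have "At_Infinity (u \<otimes> w) \<in> coset_line w B u" for u by (simp add: coset_line_def)
  then have "inj_on (coset_line w B) unitary"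
    using coset_line_unique[OF k] by (metis inj_onI)
  then have card_cosets: "card ?cosets = q + 1" using card_unitary by (simp add: card_image)
  have "Affine \<one> (g \<one>) \<in> graph g" for g using unitary_one by (auto simp: graph_def)
  then have "inj_on (\<lambda>(f, s). graph (height w f s)) ((eigenspace w - {\<zero>}) \<times> B)"
    using graph_height_unique[OF k] by (intro inj_onI) (clarsimp, metis)
  then have card_graphs: "card ?graphs = (q - 1) * q"
    using card_eigenspace_nonzero[OF Derived_indexD(1)[OF k]] card_index_set[OF k]
    by (simp add: card_image card_cartesian_product)
  have "?cosets \<inter> ?graphs = {}" by (auto simp: coset_line_def graph_def)
  then have "card (spread (Derived w B)) = (q + 1) + (q - 1) * q"
    using card_cosets card_graphs finite_unitary finite_eigenspace finite_index_set[OF k]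
    by (simp add: card_Un_disjoint)
  also have "\<dots> = q\<^sup>2 + 1" using q_gt_1 by (simp add: power2_eq_square algebra_simps)
  finally show ?thesis .
qed

lemma card_spread:
  assumes "k \<in> indices"
  shows "card (spread k) = q\<^sup>2 + 1"
proof (cases k)
  case Regular
  have "inj_on (\<lambda>z. graph (\<lambda>_. z)) (carrier K)"
    using unitary_one by (auto simp: inj_on_def graph_def)
  then have "card ((\<lambda>z. graph (\<lambda>_. z)) ` carrier K) = q\<^sup>2"
    using card_K by (simp add: card_image)
  moreover have "At_Infinity ` unitary \<notin> (\<lambda>z. graph (\<lambda>_. z)) ` carrier K"
    using unitary_one by (auto simp: graph_def)
  ultimately show ?thesis using Regular finite_K by simp
next
  case (Derived w B)
  then show ?thesis using card_spread_Derived assms by simp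
qed

lemma card_plane_points: "card plane_points = q\<^sup>2 + q + 1"
  unfolding plane_points_def using finite_unitary finite_K card_unitary card_K
  by (subst card_Un_disjoint) (auto simp: card_image inj_on_def)

lemma card_plane_line:
  assumes "k \<in> indices"
  shows "card (plane_line k) = q + 1"
proof (cases k)
  case Regular
  then show ?thesis using card_unitary by (simp add: card_image inj_on_def)
next
  case (Derived w B)
  have "card (Position ` B) = q"
    using card_index_set assms Derived by (simp add: card_image inj_on_def)
  then show ?thesis
    unfolding Derived plane_line.simps using finite_index_set assms Derived
    by (subst card_insert_disjoint) auto
qed

lemma plane_line_unique:
  assumes "k \<in> indices" "k' \<in> indices" "i \<noteq> s"
    "i \<in> plane_line k" "s \<in> plane_line k" "i \<in> plane_line k'" "s \<in> plane_line k'"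
  shows "k = k'"
proof (cases k; cases k')
  fix w B w' B' assume k: "k = Derived w B" "k' = Derived w' B'"
  show ?thesis
    using assms Derived_eqI[of w B w' B'] index_set_eqI[of w B B'] unfolding k by auto
qed (use assms in auto)

sublocale plane_indexed_parallelism q points indices spread plane_points plane_line
proof
  fix k k' L L' x y
  assume "k \<in> indices" "k' \<in> indices" "L \<in> spread k" "L' \<in> spread k'" "x \<noteq> y"
    "x \<in> L" "y \<in> L" "x \<in> L'" "y \<in> L'"
  then show "k = k'" using joined_unique[of k x y k'] by (auto simp: joined_def)
next
  fix k assume "k \<in> indices"
  then show "plane_line k \<subseteq> plane_points"
    using index_set_closed by (cases k) (auto simp: plane_points_def Derived_in_indices_iff)
next
  show "finite plane_points" using finite_unitary finite_K by (simp add: plane_points_def)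
  show "0 < q" using q_gt_1 by simp
qed (fact finite_points card_points finite_indices card_indices card_plane_points card_spread
    spread_subset card_in_spread spread_disjoint card_plane_line plane_line_unique)+

end

section \<open>A Kirkman triple system for \<open>q = 2\<close>\<close>

text \<open>The group of order 7 acts on 15 points with two regular orbits and one fixed point; the
  starting parallel class was found by computer search.\<close>

definition shift :: "nat \<Rightarrow> nat \<Rightarrow> nat" where
  "shift k x = (if x < 7 then (x + k) mod 7 else if x < 14 then 7 + (x + k) mod 7 else x)"

definition kirkman_class :: "nat \<Rightarrow> nat set set" where
  "kirkman_class k = (`) (shift k) ` {{0, 7, 14}, {1, 5, 13}, {2, 3, 12}, {8, 9, 11}, {4, 6, 10}}"

definition fano_line :: "nat \<Rightarrow> nat set" where
  "fano_line k = (\<lambda>x. (x + k) mod 7) ` {0, 1, 3}"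

lemma kirkman_class_shape:
  "\<forall>k\<in>set [0..<7]. card (kirkman_class k) = 5 \<and> (\<forall>L\<in>kirkman_class k. L \<subseteq> set [0..<15] \<and> card L = 3)"
  by code_simp

lemma kirkman_class_disjoint:
  "\<forall>k\<in>set [0..<7]. \<forall>L\<in>kirkman_class k. \<forall>L'\<in>kirkman_class k. L = L' \<or> L \<inter> L' = {}"
  by code_simp

lemma kirkman_classes_meet_in_at_most_one_point:
  "\<forall>k\<in>set [0..<7]. \<forall>k'\<in>set [0..<7]. k \<noteq> k' \<longrightarrow>
    (\<forall>L\<in>kirkman_class k. \<forall>L'\<in>kirkman_class k'. \<forall>x\<in>L \<inter> L'. \<forall>y\<in>L \<inter> L'. x = y)"
  by code_simp

lemma fano_line_shape: "\<forall>k\<in>set [0..<7]. fano_line k \<subseteq> set [0..<7] \<and> card (fano_line k) = 3"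
  by code_simp

lemma fano_lines_meet_in_at_most_one_point:
  "\<forall>k\<in>set [0..<7]. \<forall>k'\<in>set [0..<7]. k \<noteq> k' \<longrightarrow>
    (\<forall>x\<in>fano_line k \<inter> fano_line k'. \<forall>y\<in>fano_line k \<inter> fano_line k'. x = y)"
  by code_simp

interpretation kirkman: plane_indexed_parallelism 2 "set [0..<15]" "set [0..<7]" kirkman_class
  "set [0..<7]" fano_line
proof
  fix k k' L L' x y
  assume "k \<in> set [0..<7]" "k' \<in> set [0..<7]" "L \<in> kirkman_class k" "L' \<in> kirkman_class k'"
    "x \<noteq> y" "x \<in> L" "y \<in> L" "x \<in> L'" "y \<in> L'"
  then show "k = k'"
    using kirkman_classes_meet_in_at_most_one_point by (meson IntI)
next
  fix k L L' x
  assume "k \<in> set [0..<7]" "L \<in> kirkman_class k" "L' \<in> kirkman_class k" "x \<in> L" "x \<in> L'"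
  then show "L = L'" using kirkman_class_disjoint by (metis IntI empty_iff)
next
  fix k k' i s
  assume "k \<in> set [0..<7]" "k' \<in> set [0..<7]" "i \<noteq> s" "i \<in> fano_line k" "s \<in> fano_line k"
    "i \<in> fano_line k'" "s \<in> fano_line k'"
  then show "k = k'"
    using fano_lines_meet_in_at_most_one_point by (meson IntI)
next
  show "card (kirkman_class k) = 2\<^sup>2 + 1" if "k \<in> set [0..<7]" for k
    using kirkman_class_shape that by simp
  show "L \<subseteq> set [0..<15]" "card L = 2 + 1" if "k \<in> set [0..<7]" "L \<in> kirkman_class k" for k L
    using kirkman_class_shape that by simp_all
  show "fano_line k \<subseteq> set [0..<7]" "card (fano_line k) = 2 + 1" if "k \<in> set [0..<7]" for k
    using fano_line_shape that by simp_all
qed simp_all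

section \<open>Existence for prime powers\<close>

lemma exists_quadratic_finite_field:
  assumes "primepow q"
  shows "\<exists>K :: ((int list \<times> nat) multiset \<Rightarrow> int) ring. quadratic_finite_field K q"
proof -
  obtain p n where p: "Factorial_Ring.prime p" and n: "0 < n" "q = p ^ n"
    using assms by (auto simp: primepow_def)
  obtain K :: "((int list \<times> nat) multiset \<Rightarrow> int) ring" where K: "field K" "prime_char_ring K p"
    "finite (carrier K)" "card (carrier K) = p ^ (n * 2)"
    using exists_finite_field[OF p, of "n * 2"] n(1) by auto
  have "quadratic_finite_field_axioms K q"
    using K(3,4) n(2) primepow_gt_Suc_0[OF assms] prime_char_ring.pow_prime_power_add[OF K(2)]
    by unfold_locales (simp_all add: power_mult)
  then show ?thesis using K(1) by (auto simp: quadratic_finite_field_def)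
qed

lemma exists_unordered_triple_array_of_primepow:
  assumes "primepow q"
  shows "\<exists>(V :: nat set) R C. unordered_triple_array (q\<^sup>2 + q + 1) ((q + 1) * (q\<^sup>2 + 1))
    ((q\<^sup>2 + q + 1) * (q\<^sup>2 + 1)) V R C"
proof (cases "q = 2")
  case True
  then show ?thesis using kirkman.exists_unordered_triple_array by simp
next
  case False
  then have "2 < q" using primepow_gt_Suc_0[OF assms] by simp
  obtain K :: "((int list \<times> nat) multiset \<Rightarrow> int) ring" where "quadratic_finite_field K q"
    using exists_quadratic_finite_field[OF assms] by blast
  then interpret quadratic_finite_field K q .
  obtain a b where "avoids_subfield a b" using exists_avoids_subfield[OF \<open>2 < q\<close>] by blast
  then interpret avoiding_pair K q a b by unfold_locales
  show ?thesis by (rule exists_unordered_triple_array)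
qed

lemma triple_array_parameters:
  fixes q :: nat
  assumes "1 < q"
  shows "(q ^ 3 - 1) div (q - 1) = q\<^sup>2 + q + 1"
    and "(q ^ 4 - 1) div (q - 1) = (q + 1) * (q\<^sup>2 + 1)"
    and "((q ^ 4 - 1) * (q ^ 3 - 1)) div ((q ^ 2 - 1) * (q - 1)) = (q\<^sup>2 + q + 1) * (q\<^sup>2 + 1)"
proof -
  have square: "q\<^sup>2 - 1 = (q + 1) * (q - 1)"
    by (simp add: power2_eq_square algebra_simps)
  have cube: "q ^ 3 - 1 = (q\<^sup>2 + q + 1) * (q - 1)"
    by (cases q) (simp_all add: power3_eq_cube power2_eq_square algebra_simps)
  have fourth: "q ^ 4 - 1 = (q\<^sup>2 + 1) * (q\<^sup>2 - 1)"
    by (cases q) (simp_all add: power4_eq_xxxx power2_eq_square algebra_simps)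
  have nonzero: "q - 1 \<noteq> 0" "q\<^sup>2 - 1 \<noteq> 0"
    using assms by (simp, simp only: square mult_eq_0_iff) simp
  show "(q ^ 3 - 1) div (q - 1) = q\<^sup>2 + q + 1"
    unfolding cube using nonzero(1) by (rule nonzero_mult_div_cancel_right)
  have "q ^ 4 - 1 = ((q + 1) * (q\<^sup>2 + 1)) * (q - 1)" by (simp only: fourth square mult_ac)
  then show "(q ^ 4 - 1) div (q - 1) = (q + 1) * (q\<^sup>2 + 1)"
    using nonzero(1) by (metis nonzero_mult_div_cancel_right)
  have "(q ^ 4 - 1) * (q ^ 3 - 1) = ((q\<^sup>2 + q + 1) * (q\<^sup>2 + 1)) * ((q\<^sup>2 - 1) * (q - 1))"
    by (simp only: fourth cube mult_ac)
  then show "((q ^ 4 - 1) * (q ^ 3 - 1)) div ((q ^ 2 - 1) * (q - 1)) = (q\<^sup>2 + q + 1) * (q\<^sup>2 + 1)"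
    using nonzero by (metis mult_is_0 nonzero_mult_div_cancel_right)
qed

theorem theorem7:
  fixes q :: nat
  assumes "primepow q"
  shows "\<exists>(V :: nat set) R C.
    unordered_triple_array
      ((q ^ 3 - 1) div (q - 1))
      ((q ^ 4 - 1) div (q - 1))
      (((q ^ 4 - 1) * (q ^ 3 - 1)) div ((q ^ 2 - 1) * (q - 1)))
      V R C"
proof -
  have "1 < q" using primepow_gt_Suc_0[OF assms] by simp
  then show ?thesis
    using exists_unordered_triple_array_of_primepow[OF assms]
    by (simp only: triple_array_parameters)
qed

end
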